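(* Let $m\in\mathbb{N}$ and let $\alpha^{(\ell)}=\{\alpha^{(\ell)}_k\}_{k\in\mathbb{Z}}$, $\ell=1,2$, be two sequences of $m\times m$ matrices with complex entries such that $\|\alpha^{(\ell)}_k\|_{\mathbb{C}^{m\times m}}<1$ for $k\in\mathbb{Z}$, $\ell=1,2$. Let $k_0\in\mathbb{Z}$ and $N\in\mathbb{N}$. Let $g^{(\ell)}$, $h^{(\ell)}$ be the entries of the Green's matrix, defined in the context, of the full-lattice CMV operator associated with $\alpha^{(\ell)}$. Then the following hold. $(i)$ If either $h^{(1)}(0,k_0)$ or $h^{(2)}(0,k_0)$ is invertible and $$\|g^{(1)}(z,k_0)-g^{(2)}(z,k_0)\|_{\mathbb{C}^{m\times m}}+\|h^{(1)}(z,k_0)-h^{(2)}(z,k_0)\|_{\mathbb{C}^{m\times m}}=o(z^N)\quad\text{as } z\to0,$$ then $\alpha^{(1)}_k=\alpha^{(2)}_k$ for $k_0-N\le k\le k_0+N+1$. $(ii)$ If $\alpha^{(1)}_{k_0}=\alpha^{(2)}_{k_0}$, $\alpha^{(1)}_{k_0}$ is invertible, and $$\|g^{(1)}(z,k_0-1)-g^{(2)}(z,k_0-1)\|_{\mathbb{C}^{m\times m}}+\|g^{(1)}(z,k_0)-g^{(2)}(z,k_0)\|_{\mathbb{C}^{m\times m}}=o(z^N)\quad\text{as } z\to0,$$ then $\alpha^{(1)}_k=\alpha^{(2)}_k$ for $k_0-N-1\le k\le k_0+N+1$.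
   Context: $\|\cdot\|_{\mathbb{C}^{m\times m}}$ is the operator norm induced by the Euclidean norm on $\mathbb{C}^m$. Given a sequence $\alpha=\{\alpha_k\}_{k\in\mathbb{Z}}\subset\mathbb{C}^{m\times m}$ with $\|\alpha_k\|<1$, set $\rho_k=(I_m-\alpha_k^*\alpha_k)^{1/2}$, $\widetilde\rho_k=(I_m-\alpha_k\alpha_k^* )^{1/2}$, and let $\Theta_k=\begin{pmatrix}-\alpha_k&\widetilde\rho_k\\ \rho_k&\alpha_k^*\end{pmatrix}$ (a unitary $2m\times2m$ matrix). On $\ell^2(\mathbb{Z})^m$ ($\mathbb{C}^m$-valued square-summable sequences) define unitary block-diagonal operators $\mathbb{V},\mathbb{W}$: $\mathbb{V}$ acts on the coordinates $(2k-1,2k)$ by $\Theta_{2k}$, and $\mathbb{W}$ acts on the coordinates $(2k,2k+1)$ by $\Theta_{2k+1}$, for all $k\in\mathbb{Z}$. The full-lattice CMV operator is the unitary operator $\mathbb{U}=\mathbb{V}\mathbb{W}$ on $\ell^2(\mathbb{Z})^m$. For $|z|<1$, $(\mathbb{U}-zI)^{-1}(k,k')\in\mathbb{C}^{m\times m}$ denotes the $(k,k')$ block of the matrix of $(\mathbb{U}-zI)^{-1}$ in the standard basis. For $k\in\mathbb{Z}$, $|z|<1$, put $$g(z,k)=(\mathbb{U}-zI)^{-1}(k,k),\qquad h(z,k)=\begin{cases}(\mathbb{U}-zI)^{-1}(k-1,k),&k\text{ odd},\\(\mathbb{U}-zI)^{-1}(k,k-1),&k\text{ even};\end{cases}$$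 $g^{(\ell)},h^{(\ell)}$ are these functions for $\alpha=\alpha^{(\ell)}$. *)

theory Defs
  imports "HOL-Analysis.Analysis" "HOL-Library.Landau_Symbols"
begin

definition op_norm :: "complex^'m^'m \<Rightarrow> real" where
  "op_norm A = onorm (\<lambda>x. A *v x)"

definition adj_mat :: "complex^'m^'m \<Rightarrow> complex^'m^'m" where
  "adj_mat A = (\<chi> i j. cnj (A $ j $ i))"

definition psd_mat :: "complex^'m^'m \<Rightarrow> bool" where
  "psd_mat A \<longleftrightarrow> adj_mat A = A \<and> (\<forall>x. 0 \<le> Re (\<Sum>i\<in>UNIV. cnj (x $ i) * (A *v x) $ i))"

text \<open>The positive semidefinite square root; meaningful for positive semidefinite arguments only.\<close>
definition sqrt_mat :: "complex^'m^'m \<Rightarrow> complex^'m^'m" where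
  "sqrt_mat A = (THE B. psd_mat B \<and> B ** B = A)"

definition rho :: "complex^'m^'m \<Rightarrow> complex^'m^'m" where
  "rho a = sqrt_mat (mat 1 - adj_mat a ** a)"

definition rho_tilde :: "complex^'m^'m \<Rightarrow> complex^'m^'m" where
  "rho_tilde a = sqrt_mat (mat 1 - a ** adj_mat a)"

text \<open>A \<open>2m \<times> 2m\<close> matrix, kept as a \<open>2 \<times> 2\<close> array of \<open>m \<times> m\<close> blocks.\<close>
definition Theta :: "complex^'m^'m \<Rightarrow> ((complex^'m)^'m)^2^2" where
  "Theta a = vector [vector [- a, rho_tilde a], vector [rho a, adj_mat a]]"

definition ell2 :: "(int \<Rightarrow> complex^'m) set" where
  "ell2 = {f. (\<lambda>k. (norm (f k))\<^sup>2) summable_on UNIV}"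

text \<open>The operators are given by their coordinate formulas on all sequences; only their
  restrictions to \<^const>\<open>ell2\<close> matter.
  In \<open>cmv_V\<close> an even coordinate \<open>n = 2k\<close> is the second, and an odd coordinate \<open>n = 2k - 1\<close>
  the first, of the pair \<open>(2k - 1, 2k)\<close> on which \<open>Theta (\<alpha> (2k))\<close> acts. In \<open>cmv_W\<close> the pairs
  are \<open>(2k, 2k + 1)\<close> with \<open>Theta (\<alpha> (2k + 1))\<close>.\<close>
definition cmv_V :: "(int \<Rightarrow> complex^'m^'m) \<Rightarrow> (int \<Rightarrow> complex^'m) \<Rightarrow> int \<Rightarrow> complex^'m" where
  "cmv_V \<alpha> f n =
     (if even n
      then Theta (\<alpha> n) $ 2 $ 1 *v f (n - 1) + Theta (\<alpha> n) $ 2 $ 2 *v f n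
      else Theta (\<alpha> (n + 1)) $ 1 $ 1 *v f n + Theta (\<alpha> (n + 1)) $ 1 $ 2 *v f (n + 1))"

definition cmv_W :: "(int \<Rightarrow> complex^'m^'m) \<Rightarrow> (int \<Rightarrow> complex^'m) \<Rightarrow> int \<Rightarrow> complex^'m" where
  "cmv_W \<alpha> f n =
     (if odd n
      then Theta (\<alpha> n) $ 2 $ 1 *v f (n - 1) + Theta (\<alpha> n) $ 2 $ 2 *v f n
      else Theta (\<alpha> (n + 1)) $ 1 $ 1 *v f n + Theta (\<alpha> (n + 1)) $ 1 $ 2 *v f (n + 1))"

definition cmv_U :: "(int \<Rightarrow> complex^'m^'m) \<Rightarrow> (int \<Rightarrow> complex^'m) \<Rightarrow> int \<Rightarrow> complex^'m" where
  "cmv_U \<alpha> = cmv_V \<alpha> \<circ> cmv_W \<alpha>"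

text \<open>The inverse of \<open>U - zI\<close> as an operator on \<^const>\<open>ell2\<close>. Since \<open>U\<close> is unitary there,
  \<open>U - zI\<close> is a bijection of \<^const>\<open>ell2\<close> for \<open>|z| < 1\<close>.\<close>
definition cmv_resolvent ::
    "(int \<Rightarrow> complex^'m^'m) \<Rightarrow> complex \<Rightarrow> (int \<Rightarrow> complex^'m) \<Rightarrow> int \<Rightarrow> complex^'m" where
  "cmv_resolvent \<alpha> z = inv_into ell2 (\<lambda>f n. cmv_U \<alpha> f n - z *s f n)"

definition unit_seq :: "int \<Rightarrow> 'm \<Rightarrow> int \<Rightarrow> complex^'m" where
  "unit_seq k j = (\<lambda>n. if n = k then axis j 1 else 0)"

definition green :: "(int \<Rightarrow> complex^'m^'m) \<Rightarrow> complex \<Rightarrow> int \<Rightarrow> int \<Rightarrow> complex^'m^'m" where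
  "green \<alpha> z k k' = (\<chi> i j. cmv_resolvent \<alpha> z (unit_seq k' j) k $ i)"

definition g_fun :: "(int \<Rightarrow> complex^'m^'m) \<Rightarrow> complex \<Rightarrow> int \<Rightarrow> complex^'m^'m" where
  "g_fun \<alpha> z k = green \<alpha> z k k"

definition h_fun :: "(int \<Rightarrow> complex^'m^'m) \<Rightarrow> complex \<Rightarrow> int \<Rightarrow> complex^'m^'m" where
  "h_fun \<alpha> z k = (if odd k then green \<alpha> z (k - 1) k else green \<alpha> z k (k - 1))"

end

theory Submission
  imports Defs
begin

text \<open>It suffices to let \<open>z = t\<close> tend to \<open>0\<close> through positive reals.
    The equation
  \<open>(U - t) u = \<delta>\<^sub>k\<close> is equivalent to \<open>u = W\<^sup>* v\<close>, \<open>v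
      = V\<^sup>* (t u + \<delta>\<^sub>k)\<close>, which can be
  solved from the two ends of the lattice: to the right and to the left of \<open>k\<close> the components of
  \<open>u\<close> and \<open>v\<close> are related by matrix Schur functions \<open>F\<close> and
      \<open>G\<close>, with Schur parameters
  \<open>\<alpha>\<^sub>k\<^sub>+\<^sub>1, \<alpha>\<^sub>k\<^sub>+\<^sub>2, \<dots>\<close> and
      \<open>- \<alpha>\<^sub>k\<^sup>*, - \<alpha>\<^sub>k\<^sub>-\<^sub>1\<^sup>*, \<dots>\<close>.
      For even \<open>k\<close> this gives
  \<open>g = F G (1 + t g)\<close>, with the factors interchanged for odd \<open>k\<close>, and a
      similar formula for \<open>h\<close>.
  Hence \<open>g\<close> and \<open>h\<close> up to \<open>o(t\<^sup>N)\<close> determine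
      \<open>F\<close> and \<open>G\<close> up to that order, and the
  Schur algorithm recovers one coefficient on each side per order. Since only finite orders
  matter, the Schur functions are replaced by their finite approximants.\<close>

subsection \<open>The Banach algebra of complex matrices\<close>

text \<open>The obstacle is that \<open>g\<close> only yields the product of \<open>F\<close> and
  \<open>G\<close>, in a noncommutative algebra. In (i), \<open>h\<close> separates them: if
  \<open>G'\<close> is the left function one site further and \<open>a\<close> the coefficient at
  \<open>k\<close>, then for even \<open>k\<close> one has \<open>G = S Z\<close>, with
  \<open>S\<close> and \<open>Z\<close> depending on \<open>a\<close> and \<open>t G'\<close> only,
  and \<open>h\<close> yields \<open>F S\<close>. The value of \<open>F S\<close> at 0 is
  \<open>h(0)\<close>, so an invertible \<open>h(0)\<close> allows it to be cancelled from
  \<open>F G = (F S) Z\<close>. In (ii), where \<open>a\<close> is known, the Schur functions that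
  start with \<open>a\<close> are units near 0 and follow from the functions beyond \<open>k\<close>
  with a gain of one order, so the two sides feed each other. Knowing \<open>G'\<close> itself to
  order \<open>N\<close>, and not just \<open>t G'\<close>, is what adds the coefficient at
  \<open>k0 - N - 1\<close> in (ii). The estimates use no sharp constants: the defects are bounded
  by 2, which gives 9 for the inverse of \<open>U\<close>, and \<open>1/20\<close> is chosen to make
  \<open>9 t < 1\<close>.\<close>

lemma bounded_linear_matrix_vector: "bounded_linear ((*v) (A :: complex^'m^'m))"
  by (fact matrix_vector_mul_bounded_linear)

lemma scaleR_matrix_vector: "(c *\<^sub>R (A :: complex^'m^'m)) *v x = c *\<^sub>R (A *v x)"
  by (simp add: matrix_vector_mult_def vec_eq_iff scaleR_sum_right)

lemma norm_matrix_vector_le: "norm ((A :: complex^'m^'m) *v x) \<le> op_norm A * norm x"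
  unfolding op_norm_def by (rule onorm) (fact bounded_linear_matrix_vector)

lemma op_norm_mult_le: "op_norm ((A :: complex^'m^'m) ** B) \<le> op_norm A * op_norm B"
proof -
  have "(*v) (A ** B) = (*v) A \<circ> (*v) B"
    by (simp add: fun_eq_iff matrix_vector_mul_assoc)
  then show ?thesis
    unfolding op_norm_def
    using onorm_compose[OF bounded_linear_matrix_vector[of A] bounded_linear_matrix_vector[of B]] by simp
qed

lemma norm_entry_le_op_norm: "norm ((A :: complex^'m^'m) $ i $ j) \<le> op_norm A"
proof -
  have "norm (A $ i $ j) = norm ((A *v axis j 1) $ i)"
    by (simp add: matrix_vector_mult_def axis_def if_distrib[of "(*) _"] cong: if_cong)
  also have "\<dots> \<le> norm (A *v axis j 1)"
    by (rule Finite_Cartesian_Product.norm_nth_le)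
  also have "\<dots> \<le> op_norm A * norm (axis j 1 :: complex^'m)"
    by (rule norm_matrix_vector_le)
  finally show ?thesis
    by simp
qed

text \<open>Definiteness of the operator norm and completeness both come from this comparison with
  the Euclidean norm, for which they are known; the constant is just the number of entries.\<close>

lemma norm_le_op_norm: "norm (A :: complex^'m^'m) \<le> real (CARD('m) * CARD('m)) * op_norm A"
proof -
  have "norm A \<le> (\<Sum>i\<in>UNIV. norm (A $ i))"
    by (simp add: norm_vec_def L2_set_le_sum)
  also have "\<dots> \<le> (\<Sum>i\<in>UNIV. \<Sum>j\<in>UNIV. norm (A $ i $ j))"
    by (rule sum_mono) (simp add: norm_vec_def L2_set_le_sum)
  also have "\<dots> \<le> (\<Sum>i\<in>(UNIV :: 'm set). \<Sum>j\<in>(UNIV :: 'm set). op_norm A)"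
    by (intro sum_mono norm_entry_le_op_norm)
  finally show ?thesis
    by simp
qed

text \<open>A separate type, because \<open>complex^'m^'m\<close> already carries the Euclidean
  norm. Here the norm is the operator norm and multiplication the matrix product, so the class facts
  on rings and Banach spaces apply.\<close>

typedef 'm cmatrix = "UNIV :: (complex^'m^'m) set"
  morphisms mat_of of_mat ..

setup_lifting type_definition_cmatrix

instantiation cmatrix :: (finite) real_normed_algebra_1
begin

lift_definition zero_cmatrix :: "'a cmatrix" is 0 .
lift_definition one_cmatrix :: "'a cmatrix" is "mat 1" .
lift_definition plus_cmatrix :: "'a cmatrix \<Rightarrow> 'a cmatrix \<Rightarrow> 'a cmatrix" is "(+)" .
lift_definition minus_cmatrix :: "'a cmatrix \<Rightarrow> 'a cmatrix \<Rightarrow> 'a cmatrix" is "(-)" .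
lift_definition uminus_cmatrix :: "'a cmatrix \<Rightarrow> 'a cmatrix" is "uminus" .
lift_definition times_cmatrix :: "'a cmatrix \<Rightarrow> 'a cmatrix \<Rightarrow> 'a cmatrix" is "(**)" .
lift_definition scaleR_cmatrix :: "real \<Rightarrow> 'a cmatrix \<Rightarrow> 'a cmatrix" is "scaleR" .
lift_definition norm_cmatrix :: "'a cmatrix \<Rightarrow> real" is op_norm .

definition dist_cmatrix :: "'a cmatrix \<Rightarrow> 'a cmatrix \<Rightarrow> real" where
  "dist_cmatrix A B = norm (A - B)"
definition sgn_cmatrix :: "'a cmatrix \<Rightarrow> 'a cmatrix" where
  "sgn_cmatrix A = inverse (norm A) *\<^sub>R A"
definition uniformity_cmatrix :: "('a cmatrix \<times> 'a cmatrix) filter" where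
  "uniformity_cmatrix = (INF e\<in>{0<..}. principal {(x, y). dist x y < e})"
definition open_cmatrix :: "'a cmatrix set \<Rightarrow> bool" where
  "open_cmatrix U = (\<forall>x\<in>U. eventually (\<lambda>(x', y). x' = x \<longrightarrow> y \<in>
      U) uniformity)"

instance
proof
  fix A B C :: "'a cmatrix" and c d :: real
  show "A + B + C = A + (B + C)" "A + B = B + A" "0 + A = A" "- A + A = 0" "A - B = A + - B"
    "c *\<^sub>R (A + B) = c *\<^sub>R A + c *\<^sub>R B" "(c + d) *\<^sub>R A = c *\<^sub>R A + d
        *\<^sub>R A"
    "c *\<^sub>R d *\<^sub>R A = (c * d) *\<^sub>R A" "1 *\<^sub>R A = A"
    by (transfer; simp add: algebra_simps)+
  show "A * B * C = A * (B * C)"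
    by transfer (simp add: matrix_mul_assoc)
  show "(A + B) * C = A * C + B * C"
    by transfer (simp add: matrix_matrix_mult_def vec_eq_iff distrib_right sum.distrib)
  show "A * (B + C) = A * B + A * C"
    by transfer (simp add: matrix_matrix_mult_def vec_eq_iff distrib_left sum.distrib)
  show "1 * A = A" "A * 1 = A"
    by (transfer; simp)+
  show "c *\<^sub>R A * B = c *\<^sub>R (A * B)" "A * c *\<^sub>R B = c *\<^sub>R (A * B)"
    by (transfer; simp add: matrix_matrix_mult_def vec_eq_iff scaleR_sum_right)+
  show "(0 :: 'a cmatrix) \<noteq> 1"
    by transfer (auto simp: mat_def vec_eq_iff)
  show "dist A B = norm (A - B)" "sgn A = inverse (norm A) *\<^sub>R A"
    by (simp_all add: dist_cmatrix_def sgn_cmatrix_def)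
  show "(uniformity :: ('a cmatrix \<times> 'a cmatrix) filter) = (INF e\<in>{0<..}. principal {(x, y).
      dist x y < e})"
    by (fact uniformity_cmatrix_def)
  show "open U = (\<forall>x\<in>U. eventually (\<lambda>(x', y). x' = x \<longrightarrow> y \<in> U)
      uniformity)" for U :: "'a cmatrix set"
    by (fact open_cmatrix_def)
  show "norm A = 0 \<longleftrightarrow> A = 0"
  proof transfer
    fix A :: "complex^'a^'a"
    show "op_norm A = 0 \<longleftrightarrow> A = 0"
      using norm_le_op_norm[of A] by (auto simp: op_norm_def onorm_zero)
  qed
  show "norm (A + B) \<le> norm A + norm B"
    by transfer (simp add: op_norm_def matrix_vector_mult_add_rdistrib
        onorm_triangle[OF bounded_linear_matrix_vector bounded_linear_matrix_vector])
  show "norm (c *\<^sub>R A) = \<bar>c\<bar> * norm A"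
    by transfer (simp add: op_norm_def scaleR_matrix_vector onorm_scaleR[OF bounded_linear_matrix_vector])
  show "norm (A * B) \<le> norm A * norm B"
    by transfer (rule op_norm_mult_le)
  show "norm (1 :: 'a cmatrix) = 1"
    by transfer (simp add: op_norm_def onorm_id)
qed

end

lemma bounded_linear_of_mat: "bounded_linear (of_mat :: complex^'m^'m \<Rightarrow> 'm cmatrix)"
  by (intro linear_conv_bounded_linear[THEN iffD1] linearI)
     (simp_all add: plus_cmatrix.abs_eq scaleR_cmatrix.abs_eq)

instance cmatrix :: (finite) banach
proof
  fix X :: "nat \<Rightarrow> 'a cmatrix"
  assume X: "Cauchy X"
  define c where "c = real (CARD('a) * CARD('a))"
  have c: "0 < c"
    by (simp add: c_def)
  have "Cauchy (\<lambda>n. mat_of (X n))"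
  proof (rule CauchyI)
    fix e :: real
    assume "0 < e"
    with c have "0 < e / c"
      by simp
    then obtain M where M: "\<And>m n. M \<le> m \<Longrightarrow> M \<le> n \<Longrightarrow> norm (X
        m - X n) < e / c"
      using CauchyD[OF X] by blast
    have "norm (mat_of (X m) - mat_of (X n)) < e" if "M \<le> m" "M \<le> n" for m n
    proof -
      have "norm (mat_of (X m) - mat_of (X n)) \<le> c * norm (X m - X n)"
        using norm_le_op_norm[of "mat_of (X m) - mat_of (X n)"]
        by (simp add: c_def norm_cmatrix.rep_eq minus_cmatrix.rep_eq)
      also have "\<dots> < e"
        using M[OF that] c by (simp add: field_simps)
      finally show ?thesis .
    qed
    then show "\<exists>M. \<forall>m\<ge>M. \<forall>n\<ge>M. norm (mat_of (X m) - mat_of (X n)) < e"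
      by blast
  qed
  then obtain L where "(\<lambda>n. mat_of (X n)) \<longlonglongrightarrow> L"
    by (auto simp: Cauchy_convergent_iff convergent_def)
  then have "(\<lambda>n. of_mat (mat_of (X n))) \<longlonglongrightarrow> of_mat L"
    by (rule bounded_linear.tendsto[OF bounded_linear_of_mat])
  then show "convergent X"
    by (auto simp: mat_of_inverse convergent_def)
qed

section \<open>Inverses and square roots of \<open>1 - X\<close> in a Banach algebra\<close>

definition rinv :: "'a::ring_1 \<Rightarrow> 'a" where
  "rinv x = (THE y. x * y = 1 \<and> y * x = 1)"

lemma rinv_eqI:
  assumes "x * y = 1" and "y * x = 1"
  shows "rinv x = y"
  unfolding rinv_def
proof (rule the_equality)
  fix z
  assume z: "x * z = 1 \<and> z * x = 1"
  have "z = z * (x * y)"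
    using assms by simp
  also have "\<dots> = y"
    using z by (simp add: mult.assoc[symmetric])
  finally show "z = y" .
qed (use assms in simp)

text \<open>The maps \<open>y |-> 1 + x * y\<close> and \<open>z |-> 1 + z * x\<close> are
  contractions; their fixed points are a right and a left inverse, hence equal. \<open>rinv\<close>
  is a definite description, so it can be computed with only once such an inverse is
  exhibited.\<close>

lemma one_minus_invertible:
  fixes x :: "'a::{real_normed_algebra_1,banach}"
  assumes "norm x < 1"
  shows "(1 - x) * rinv (1 - x) = 1" and "rinv (1 - x) * (1 - x) = 1"
    and "norm (rinv (1 - x)) \<le> 1 / (1 - norm x)"
proof -
  have "dist (1 + x * y) (1 + x * z) \<le> norm x * dist y z" for y z
    by (simp add: dist_norm right_diff_distrib[symmetric] norm_mult_ineq)
  from banach_fix_type[of "norm x" "\<lambda>y. 1 + x * y"] this assms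
  obtain y where y: "1 + x * y = y"
    by auto
  have "dist (1 + y * x) (1 + z * x) \<le> norm x * dist y z" for y z
    by (simp add: dist_norm left_diff_distrib[symmetric] norm_mult_ineq mult.commute[of "norm x"])
  from banach_fix_type[of "norm x" "\<lambda>y. 1 + y * x"] this assms
  obtain z where z: "1 + z * x = z"
    by auto
  have 1: "(1 - x) * y = 1"
    using y by (simp add: algebra_simps)
  have 2: "z * (1 - x) = 1"
    using z by (simp add: algebra_simps)
  have "z = z * ((1 - x) * y)"
    by (simp add: 1)
  also have "\<dots> = y"
    by (simp only: mult.assoc[symmetric] 2) simp
  finally have zy: "z = y" .
  have r: "rinv (1 - x) = y"
    using 1 2 zy by (intro rinv_eqI) simp_all
  show "(1 - x) * rinv (1 - x) = 1" "rinv (1 - x) * (1 - x) = 1"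
    using 1 2 zy r by simp_all
  have "norm y = norm (1 + x * y)"
    by (simp add: y)
  also have "\<dots> \<le> 1 + norm x * norm y"
    using norm_triangle_ineq[of 1 "x * y"] norm_mult_ineq[of x y] by simp
  finally show "norm (rinv (1 - x)) \<le> 1 / (1 - norm x)"
    using assms by (simp add: r field_simps)
qed

text \<open>Square roots of \<open>1 - X\<close> are sought in the form \<open>1 - Y\<close>, where
    \<open>Y\<close> is a fixed point of
  the contraction \<open>Y \<mapsto> (X + Y\<^sup>2) / 2\<close> of a ball of radius less than 1.\<close>

lemma ex_one_minus_sqrt:
  fixes X :: "'a::{real_normed_algebra_1,banach}"
  assumes X: "norm X < 1"
  shows "\<exists>Y. norm Y < 1 \<and> Y + Y = X + Y * Y"
proof -
  \<comment> \<open>The smaller root of \<open>\<rho>^2 - 2 \<rho> + norm X = 0\<close>: the ball of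
    radius \<open>\<rho>\<close> is mapped into itself, and \<open>\<rho> < 1\<close> is also the
    contraction constant.\<close>
  define \<rho> where "\<rho> = 1 - sqrt (1 - norm X)"
  have \<rho>: "0 \<le> \<rho>" "\<rho> < 1" "norm X + \<rho> * \<rho> = 2 * \<rho>"
    using X by (simp_all add: \<rho>_def algebra_simps)
  define f where "f Y = (1/2) *\<^sub>R (X + Y * Y)" for Y
  have ball: "norm (f Y) \<le> \<rho>" if "norm Y \<le> \<rho>" for Y
  proof -
    have "norm (f Y) \<le> (norm X + norm Y * norm Y) / 2"
      using norm_triangle_ineq[of X "Y * Y"] norm_mult_ineq[of Y Y] by (simp add: f_def)
    also have "\<dots> \<le> (norm X + \<rho> * \<rho>) / 2"
      using that \<rho>(1) by (intro divide_right_mono add_left_mono mult_mono) simp_all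
    finally show ?thesis
      using \<rho> by simp
  qed
  have lip: "dist (f Y) (f Z) \<le> \<rho> * dist Y Z" if "norm Y \<le> \<rho>" "norm Z \<le> \<rho>" for Y Z
  proof -
    have "f Y - f Z = (1/2) *\<^sub>R (Y * (Y - Z) + (Y - Z) * Z)"
      by (simp add: f_def algebra_simps)
    then have "norm (f Y - f Z) \<le> (norm (Y * (Y - Z)) + norm ((Y - Z) * Z)) / 2"
      using norm_triangle_ineq[of "Y * (Y - Z)" "(Y - Z) * Z"] by simp
    also have "\<dots> \<le> (norm Y * norm (Y - Z) + norm (Y - Z) * norm Z) / 2"
      using norm_mult_ineq[of Y "Y - Z"] norm_mult_ineq[of "Y - Z" Z] by simp
    also have "\<dots> \<le> (\<rho> * norm (Y - Z) + norm (Y - Z) * \<rho>) / 2"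
      using that \<rho>(1) by (intro divide_right_mono add_mono mult_mono) simp_all
    finally show ?thesis
      by (simp add: dist_norm mult.commute)
  qed
  have "\<exists>!Y\<in>cball 0 \<rho>. f Y = Y"
    using \<rho> ball lip
    by (intro Banach_fix) (auto simp: complete_eq_closed)
  then obtain Y where Y: "norm Y \<le> \<rho>" "f Y = Y"
    by auto
  have "Y + Y = X + Y * Y"
    using arg_cong[OF Y(2), of "\<lambda>y. 2 *\<^sub>R y"] by (simp add: f_def scaleR_2)
  with Y \<rho> show ?thesis
    by (intro exI[of _ Y]) simp
qed

text \<open>The difference \<open>D = a * Y - Z * a\<close> satisfies
  \<open>2 D = D * Y + Z * D\<close>, and since both norms are below 1 this forces
  \<open>D = 0\<close>. With \<open>a = 1\<close> this is uniqueness of \<open>Y\<close>; with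
  \<open>a\<close> commuting with \<open>X\<close> it is commutation with \<open>Y\<close>.\<close>

lemma one_minus_sqrt_intertwines:
  fixes X Y Z W a :: "'a::real_normed_algebra_1"
  assumes Y: "norm Y < 1" "Y + Y = X + Y * Y" and Z: "norm Z < 1" "Z + Z = W + Z * Z"
    and a: "a * X = W * a"
  shows "a * Y = Z * a"
proof -
  define D where "D = a * Y - Z * a"
  have "D + D = a * (Y + Y) - (Z + Z) * a"
    by (simp add: D_def algebra_simps)
  also have "\<dots> = D * Y + Z * D"
    by (simp add: Y(2) Z(2) D_def algebra_simps a)
  finally have "norm (2 *\<^sub>R D) = norm (D * Y + Z * D)"
    by (simp add: scaleR_2)
  also have "\<dots> \<le> norm D * norm Y + norm Z * norm D"
    using norm_triangle_ineq[of "D * Y" "Z * D"] norm_mult_ineq[of D Y] norm_mult_ineq[of Z D] by simp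
  finally have "norm D * ((1 - norm Y) + (1 - norm Z)) \<le> 0"
    by (simp add: algebra_simps)
  then have "norm D \<le> 0"
    using Y Z by (simp add: mult_le_0_iff)
  then show ?thesis
    by (simp add: D_def)
qed

subsection \<open>Adjoints and defect operators\<close>

lift_definition adj :: "'m::finite cmatrix \<Rightarrow> 'm cmatrix" is adj_mat .
lift_definition defect :: "'m::finite cmatrix \<Rightarrow> 'm cmatrix" is rho .

lemma adj_mat_simps:
  fixes A B :: "complex^'m^'m"
  shows "adj_mat (adj_mat A) = A" "adj_mat (A + B) = adj_mat A + adj_mat B"
    "adj_mat (A - B) = adj_mat A - adj_mat B" "adj_mat (- A) = - adj_mat A"
    "adj_mat (A ** B) = adj_mat B ** adj_mat A" "adj_mat (mat 1 :: complex^'m^'m) = mat 1"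
  by (auto simp: adj_mat_def vec_eq_iff matrix_matrix_mult_def mat_def mult.commute)

lemma adj_simps [simp]:
  fixes A B :: "'m::finite cmatrix"
  shows "adj (adj A) = A" "adj (A + B) = adj A + adj B" "adj (A - B) = adj A - adj B"
    "adj (- A) = - adj A" "adj (A * B) = adj B * adj A" "adj (1 :: 'm cmatrix) = 1"
  by (transfer; simp add: adj_mat_simps)+

lemma inner_complex_vec: "x \<bullet> y = Re (\<Sum>i\<in>UNIV. cnj (x $ i) * y $ i)" for x y :: "complex^'m"
  by (simp add: inner_vec_def inner_complex_def)

lemma inner_adj_mat: "(adj_mat A *v x) \<bullet> y = x \<bullet> (A *v y)" for A :: "complex^'m^'m"
proof -
  have "(\<Sum>i\<in>UNIV. cnj ((adj_mat A *v x) $ i) * y $ i) = (\<Sum>i\<in>UNIV. cnj (x $ i) * (A *v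
      y) $ i)"
    unfolding matrix_vector_mult_def adj_mat_def
    by (simp add: sum_distrib_left sum_distrib_right, subst sum.swap) (simp add: mult_ac)
  then show ?thesis
    by (simp add: inner_complex_vec)
qed

lemma psd_mat_iff: "psd_mat A \<longleftrightarrow> adj_mat A = A \<and> (\<forall>x. 0 \<le> x
    \<bullet> (A *v x))"
  by (simp add: psd_mat_def inner_complex_vec)

lemma op_norm_adj_mat_le: "op_norm (adj_mat A) \<le> op_norm (A :: complex^'m^'m)"
  unfolding op_norm_def[of "adj_mat A"]
proof (rule onorm_le)
  fix x :: "complex^'m"
  define y where "y = adj_mat A *v x"
  have "norm y * norm y = x \<bullet> (A *v y)"
    by (simp add: y_def inner_adj_mat[symmetric] power2_norm_eq_inner[symmetric] power2_eq_square)
  also have "\<dots> \<le> norm x * norm (A *v y)"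
    by (rule norm_cauchy_schwarz)
  also have "\<dots> \<le> norm x * (op_norm A * norm y)"
    by (intro mult_left_mono norm_matrix_vector_le) simp
  finally have "norm y * norm y \<le> (op_norm A * norm x) * norm y"
    by (simp add: mult_ac)
  then show "norm (adj_mat A *v x) \<le> op_norm A * norm x"
    unfolding y_def[symmetric]
    by (cases "y = 0") (auto simp: op_norm_def onorm_pos_le[OF bounded_linear_matrix_vector])
qed

lemma norm_adj [simp]: "norm (adj A) = norm A"
proof (rule antisym)
  show *: "norm (adj A) \<le> norm A" for A :: "'m::finite cmatrix"
    by transfer (rule op_norm_adj_mat_le)
  show "norm A \<le> norm (adj A)"
    using *[of "adj A"] by simp
qed

lemma norm_adj_mult_self_less_1:
  assumes "norm a < 1"
  shows "norm (adj a * a) < 1"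
proof -
  have "norm (adj a * a) \<le> norm a * norm a"
    using norm_mult_ineq[of "adj a" a] by simp
  also have "\<dots> < 1"
    using assms by (simp add: mult_strict_mono'[of "norm a" 1 "norm a" 1, simplified])
  finally show ?thesis .
qed

lemma adj_one_minus_sqrt:
  assumes X: "adj X = X" and Y: "norm Y < 1" "Y + Y = X + Y * Y"
  shows "adj Y = Y"
proof -
  \<comment> \<open>\<open>adj Y\<close> solves the same equation and has the same norm, so
    uniqueness gives \<open>adj Y = Y\<close>.\<close>
  have "adj Y + adj Y = X + adj Y * adj Y"
    using arg_cong[OF Y(2), of adj] by (simp add: X)
  then show ?thesis
    using one_minus_sqrt_intertwines[of "adj Y" X Y X 1] Y by simp
qed

text \<open>\<open>1 - Y\<close> is bounded below by \<open>1 - norm Y > 0\<close>, hence positive.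
  A second positive root \<open>C\<close> commutes with \<open>X = 1 - C * C\<close>, so with
  \<open>Y\<close>, and the difference of the two squares factors; the factor
  \<open>C + (1 - Y)\<close> is injective by the same lower bound.\<close>

lemma sqrt_mat_one_minus:
  fixes X Y :: "'m::finite cmatrix"
  assumes X: "adj X = X" and Y: "norm Y < 1" "Y + Y = X + Y * Y"
  shows "sqrt_mat (mat 1 - mat_of X) = mat 1 - mat_of Y"
  unfolding sqrt_mat_def
proof (rule the_equality)
  have "adj (1 - Y) = 1 - Y"
    by (simp add: adj_one_minus_sqrt[OF X Y])
  then have 1: "adj_mat (mat 1 - mat_of Y) = mat 1 - mat_of Y"
    by transfer
  have pos: "(1 - norm Y) * (x \<bullet> x) \<le> x \<bullet> ((mat 1 - mat_of Y) *v x)" for x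
  proof -
    have "x \<bullet> (mat_of Y *v x) \<le> norm x * norm (mat_of Y *v x)"
      by (rule norm_cauchy_schwarz)
    also have "\<dots> \<le> norm x * (norm Y * norm x)"
      by (intro mult_left_mono) (simp_all add: norm_cmatrix.rep_eq norm_matrix_vector_le)
    also have "\<dots> = norm Y * (x \<bullet> x)"
      by (simp add: power2_norm_eq_inner[symmetric] power2_eq_square)
    finally show ?thesis
      by (simp add: matrix_vector_mult_diff_rdistrib inner_diff_right algebra_simps)
  qed
  have "0 \<le> x \<bullet> ((mat 1 - mat_of Y) *v x)" for x
    using Y by (intro order_trans[OF _ pos]) simp
  with 1 have psd: "psd_mat (mat 1 - mat_of Y)"
    by (simp add: psd_mat_iff)
  have "(1 - Y) * (1 - Y) = 1 - (Y + Y) + Y * Y"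
    by (simp add: algebra_simps)
  also have "\<dots> = 1 - X"
    by (simp add: Y(2))
  finally have "(1 - Y) * (1 - Y) = 1 - X" .
  then have "(mat 1 - mat_of Y) ** (mat 1 - mat_of Y) = mat 1 - mat_of X"
    by transfer
  with psd show "psd_mat (mat 1 - mat_of Y) \<and> (mat 1 - mat_of Y) ** (mat 1 - mat_of Y) = mat 1 -
      mat_of X"
    by simp
  fix B
  assume B: "psd_mat B \<and> B ** B = mat 1 - mat_of X"
  define C where "C = of_mat B"
  have C: "mat_of C = B"
    by (simp add: C_def of_mat_inverse)
  have "C * C = 1 - X"
    using B unfolding C[symmetric] by (transfer) simp
  then have X': "X = 1 - C * C"
    by simp
  have "C * Y = Y * C"
    by (rule one_minus_sqrt_intertwines[OF Y Y]) (simp add: X' algebra_simps)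
  then have "(C + (1 - Y)) * (C - (1 - Y)) = C * C - 1 + (Y + Y - Y * Y)"
    by (simp add: algebra_simps)
  then have 0: "(C + (1 - Y)) * (C - (1 - Y)) = 0"
    by (simp add: X' Y(2))
  have "mat_of (C + (1 - Y)) *v x = 0 \<Longrightarrow> x = 0" for x
  proof -
    assume "mat_of (C + (1 - Y)) *v x = 0"
    then have "0 = x \<bullet> (B *v x) + x \<bullet> ((mat 1 - mat_of Y) *v x)"
      by (simp add: plus_cmatrix.rep_eq minus_cmatrix.rep_eq one_cmatrix.rep_eq C
          matrix_vector_mult_add_rdistrib inner_add_right[symmetric])
    moreover have "0 \<le> x \<bullet> (B *v x)"
      using B by (simp add: psd_mat_iff)
    ultimately have "(1 - norm Y) * (x \<bullet> x) \<le> 0"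
      using pos[of x] by linarith
    then show "x = 0"
      using Y inner_ge_zero[of x] by (auto simp: mult_le_0_iff simp del: inner_ge_zero)
  qed
  \<comment> \<open>In finite dimension injectivity yields a left inverse, which cancels the first
    factor.\<close>
  then obtain E where E: "E ** mat_of (C + (1 - Y)) = mat 1"
    by (metis matrix_left_invertible_ker)
  have "mat_of (C + (1 - Y)) ** mat_of (C - (1 - Y)) = 0"
    using 0 by transfer
  then have "E ** mat_of (C + (1 - Y)) ** mat_of (C - (1 - Y)) = 0"
    by (simp add: matrix_mul_assoc[symmetric])
  then have "mat_of (C - (1 - Y)) = 0"
    by (simp add: E)
  then show "B = mat 1 - mat_of Y"
    by (simp add: minus_cmatrix.rep_eq one_cmatrix.rep_eq C)
qed

lemma defect_eq:
  fixes a :: "'m::finite cmatrix"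
  assumes a: "norm a < 1"
  obtains Y where "defect a = 1 - Y" and "norm Y < 1" and "Y + Y = adj a * a + Y * Y"
proof -
  obtain Y where Y: "norm Y < 1" "Y + Y = adj a * a + Y * Y"
    using ex_one_minus_sqrt[OF norm_adj_mult_self_less_1[OF a]] by blast
  have "sqrt_mat (mat 1 - mat_of (adj a * a)) = mat 1 - mat_of Y"
    using Y by (intro sqrt_mat_one_minus) simp_all
  then have "defect a = 1 - Y"
    by (transfer) (simp add: rho_def)
  with Y that show thesis
    by blast
qed

lemma defect_square:
  assumes "norm a < 1"
  shows "defect a * defect a = 1 - adj a * a"
proof -
  obtain Y where Y: "defect a = 1 - Y" "Y + Y = adj a * a + Y * Y"
    by (rule defect_eq[OF assms])
  have "defect a * defect a = 1 - (Y + Y) + Y * Y"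
    by (simp add: Y(1) algebra_simps)
  also have "\<dots> = 1 - adj a * a"
    by (simp add: Y(2))
  finally show ?thesis .
qed

lemma norm_defect_le:
  assumes "norm a < 1"
  shows "norm (defect a) \<le> 2"
proof -
  obtain Y where "defect a = 1 - Y" "norm Y < 1"
    by (rule defect_eq[OF assms])
  then show ?thesis
    using norm_triangle_ineq4[of 1 Y] by simp
qed

lemma defect_inverse:
  assumes "norm a < 1"
  shows "defect a * rinv (defect a) = 1" "rinv (defect a) * defect a = 1"
proof -
  obtain Y where "defect a = 1 - Y" "norm Y < 1"
    by (rule defect_eq[OF assms])
  then show "defect a * rinv (defect a) = 1" "rinv (defect a) * defect a = 1"
    using one_minus_invertible[of Y] by simp_all
qed

text \<open>Since \<open>a * (adj a * a) = (a * adj a) * a\<close>, the intertwining passes from the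
  squares to the roots.\<close>

lemma defect_intertwines:
  assumes a: "norm a < 1"
  shows "a * defect a = defect (adj a) * a"
proof -
  obtain Y where Y: "defect a = 1 - Y" "norm Y < 1" "Y + Y = adj a * a + Y * Y"
    by (rule defect_eq[OF assms])
  obtain Z where Z: "defect (adj a) = 1 - Z" "norm Z < 1" "Z + Z = a * adj a + Z * Z"
    using defect_eq[of "adj a"] assms by auto
  have "a * Y = Z * a"
    by (rule one_minus_sqrt_intertwines[OF Y(2,3) Z(2,3)]) (simp add: mult.assoc)
  then show ?thesis
    by (simp add: Y(1) Z(1) algebra_simps)
qed

lemma defect_cong: "adj a * a = adj b * b \<Longrightarrow> defect a = defect b"
  by transfer (simp add: rho_def)

lemma defect_uminus [simp]: "defect (- a) = defect a"
  by (rule defect_cong) simp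

lemma adj_defect:
  assumes a: "norm a < 1"
  shows "adj (defect a) = defect a"
proof -
  obtain Y where Y: "defect a = 1 - Y" "norm Y < 1" "Y + Y = adj a * a + Y * Y"
    by (rule defect_eq[OF assms])
  have "adj Y = Y"
    by (rule adj_one_minus_sqrt[OF _ Y(2,3)]) simp
  then show ?thesis
    by (simp add: Y(1))
qed

text \<open>For \<open>s\<^sub>i = defect (adj a\<^sub>i)\<close> and \<open>X =
    s\<^sub>i\<^sup>-\<^sup>1 a\<^sub>i\<close> one has \<open>1 + X X\<^sup>* =
    s\<^sub>i\<^sup>-\<^sup>2\<close>.\<close>

lemma rinv_defect_mult_inject:
  assumes a: "norm a1 < 1" "norm a2 < 1"
    and eq: "rinv (defect (adj a1)) * a1 = rinv (defect (adj a2)) * a2"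
  shows "a1 = a2"
proof -
  define s1 s2 where s: "s1 = defect (adj a1)" "s2 = defect (adj a2)"
  define t1 t2 where t: "t1 = rinv s1" "t2 = rinv s2"
  have inv: "s1 * t1 = 1" "t1 * s1 = 1" "s2 * t2 = 1" "t2 * s2 = 1"
    unfolding t s by (simp_all add: a defect_inverse)
  have adj_s: "adj s1 = s1" "adj s2 = s2"
    by (simp_all add: s adj_defect a)
  have adj_t: "adj t1 = t1" "adj t2 = t2"
    using inv[THEN arg_cong[of _ _ adj]] adj_s
    unfolding t by (metis adj_simps(5,6) rinv_eqI)+
  have sq: "s1 * s1 = 1 - a1 * adj a1" "s2 * s2 = 1 - a2 * adj a2"
    using defect_square[of "adj a1"] defect_square[of "adj a2"] a by (simp_all add: s)
  have X: "t1 * a1 * adj (t1 * a1) = t1 * t1 - 1" "t2 * a2 * adj (t2 * a2) = t2 * t2 - 1"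
  proof -
    have "t1 * a1 * adj (t1 * a1) = t1 * (1 - s1 * s1) * t1"
      by (simp add: sq adj_t mult.assoc)
    also have "\<dots> = t1 * t1 - (t1 * s1) * (s1 * t1)"
      by (simp add: algebra_simps)
    finally show "t1 * a1 * adj (t1 * a1) = t1 * t1 - 1"
      by (simp add: inv)
    have "t2 * a2 * adj (t2 * a2) = t2 * (1 - s2 * s2) * t2"
      by (simp add: sq adj_t mult.assoc)
    also have "\<dots> = t2 * t2 - (t2 * s2) * (s2 * t2)"
      by (simp add: algebra_simps)
    finally show "t2 * a2 * adj (t2 * a2) = t2 * t2 - 1"
      by (simp add: inv)
  qed
  have tt: "t1 * t1 = t2 * t2"
    using X eq by (simp add: s t)
  have "s1 * s1 = s1 * s1 * (t2 * (t2 * s2) * s2)"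
    by (simp add: inv)
  also have "\<dots> = s1 * s1 * (t2 * t2) * s2 * s2"
    by (simp add: mult.assoc)
  also have "\<dots> = s1 * (s1 * t1) * t1 * s2 * s2"
    by (simp add: tt[symmetric] mult.assoc)
  also have "\<dots> = s2 * s2"
    by (simp add: inv)
  finally have "a1 * adj a1 = a2 * adj a2"
    by (simp add: sq)
  \<comment> \<open>\<open>defect (adj a)\<close> depends on \<open>a * adj a\<close> alone, so the
    defects agree, and \<open>a1 = s1 * (t1 * a1)\<close> recovers the coefficient.\<close>
  then have ss: "s1 = s2"
    unfolding s by (intro defect_cong) simp
  have "a1 = s1 * (t1 * a1)"
    by (simp add: mult.assoc[symmetric] inv)
  also have "\<dots> = s2 * (t2 * a2)"
    using eq ss by (simp add: s t)
  also have "\<dots> = a2"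
    by (simp add: mult.assoc[symmetric] inv)
  finally show ?thesis .
qed

subsection \<open>Orders of vanishing at \<open>0+\<close>\<close>

abbreviation bdd :: "(real \<Rightarrow> 'a::real_normed_vector) \<Rightarrow> bool" where
  "bdd f \<equiv> Bfun f (at_right 0)"

text \<open>This is \<open>o(t^N)\<close> as real \<open>t\<close> decreases to 0, so that
  \<open>oeq N\<close> below retains the coefficients of \<open>t^0\<close> up to and including
  \<open>t^N\<close>; \<open>small 0\<close> just says that the limit is 0.\<close>

definition small :: "nat \<Rightarrow> (real \<Rightarrow> 'a::real_normed_vector) \<Rightarrow> bool" where
  "small N f \<longleftrightarrow> Zfun (\<lambda>t. f t /\<^sub>R t ^ N) (at_right 0)"

definition oeq :: "nat \<Rightarrow> (real \<Rightarrow> 'a::real_normed_vector) \<Rightarrow> (real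
    \<Rightarrow> 'a) \<Rightarrow> bool" where
  "oeq N f g \<longleftrightarrow> small N (\<lambda>t. f t - g t)"

lemma eventually_at_right_0: "eventually (\<lambda>t::real. 0 < t) (at_right 0)"
  by (simp add: eventually_at_right_less)

named_theorems bdd_intros

lemma bdd_const [bdd_intros]: "bdd (\<lambda>_. c)"
  by simp

lemma bdd_add [bdd_intros]:
  assumes "bdd f" "bdd g"
  shows "bdd (\<lambda>t. f t + g t)"
proof -
  obtain A B where "eventually (\<lambda>t. norm (f t) \<le> A) (at_right 0)" "eventually (\<lambda>t.
      norm (g t) \<le> B) (at_right 0)"
    using assms by (auto simp: Bfun_def)
  then have "eventually (\<lambda>t. norm (f t + g t) \<le> A + B) (at_right 0)"
    by eventually_elim (rule norm_triangle_mono)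
  then show ?thesis
    by (rule BfunI)
qed

lemma bdd_uminus [bdd_intros]: "bdd f \<Longrightarrow> bdd (\<lambda>t. - f t)"
  by (simp add: Bfun_def)

lemma bdd_diff [bdd_intros]: "bdd f \<Longrightarrow> bdd g \<Longrightarrow> bdd (\<lambda>t. f t - g t)"
  using bdd_add[OF _ bdd_uminus, of f g] by simp

lemma bdd_mult [bdd_intros]:
  fixes f g :: "real \<Rightarrow> 'a::real_normed_algebra"
  assumes "bdd f" "bdd g"
  shows "bdd (\<lambda>t. f t * g t)"
proof -
  obtain A B where A: "0 < A" and ev: "eventually (\<lambda>t. norm (f t) \<le> A) (at_right 0)"
      "eventually (\<lambda>t. norm (g t) \<le> B) (at_right 0)"
    using assms by (auto simp: Bfun_def)
  from ev have "eventually (\<lambda>t. norm (f t * g t) \<le> A * B) (at_right 0)"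
    by eventually_elim (rule order_trans[OF norm_mult_ineq], use A in \<open>auto intro!: mult_mono\<close>)
  then show ?thesis
    by (rule BfunI)
qed

lemma bdd_scale [bdd_intros]:
  assumes "bdd f"
  shows "bdd (\<lambda>t. t *\<^sub>R f t)"
proof -
  obtain A where A: "0 < A" and ev: "eventually (\<lambda>t. norm (f t) \<le> A) (at_right 0)"
    using assms by (auto simp: Bfun_def)
  have "eventually (\<lambda>t::real. t < 1) (at_right 0)"
    by (rule order_tendstoD(2)[OF tendsto_ident_at]) simp
  with ev eventually_at_right_0 have "eventually (\<lambda>t. norm (t *\<^sub>R f t) \<le> 1 * A)
      (at_right 0)"
    by eventually_elim (unfold norm_scaleR, rule mult_mono, auto)
  then show ?thesis
    by (rule BfunI)
qed

lemma small_add: "small N f \<Longrightarrow> small N g \<Longrightarrow> small N (\<lambda>t. f t + g t)"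
  unfolding small_def by (drule (1) Zfun_add) (simp add: scaleR_add_right)

lemma small_uminus: "small N f \<Longrightarrow> small N (\<lambda>t. - f t)"
  unfolding small_def by (drule Zfun_minus) simp

lemma small_diff: "small N f \<Longrightarrow> small N g \<Longrightarrow> small N (\<lambda>t. f t - g t)"
  using small_add[OF _ small_uminus, of N f g] by simp

lemma small_mult_left:
  fixes f g :: "real \<Rightarrow> 'a::real_normed_algebra"
  shows "bdd f \<Longrightarrow> small N g \<Longrightarrow> small N (\<lambda>t. f t * g t)"
  unfolding small_def by (drule (1) bounded_bilinear.Bfun_prod_Zfun[OF bounded_bilinear_mult]) simp

lemma small_mult_right:
  fixes f g :: "real \<Rightarrow> 'a::real_normed_algebra"
  shows "small N f \<Longrightarrow> bdd g \<Longrightarrow> small N (\<lambda>t. f t * g t)"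
  unfolding small_def by (drule (1) bounded_bilinear.Zfun_prod_Bfun[OF bounded_bilinear_mult]) simp

lemma small_cong:
  assumes "small N f" "eventually (\<lambda>t. f t = g t) (at_right 0)"
  shows "small N g"
  unfolding small_def
proof (rule Zfun_ssubst)
  show "Zfun (\<lambda>t. f t /\<^sub>R t ^ N) (at_right 0)"
    using assms(1) by (simp add: small_def)
  show "eventually (\<lambda>t. g t /\<^sub>R t ^ N = f t /\<^sub>R t ^ N) (at_right 0)"
    using assms(2) by eventually_elim simp
qed

text \<open>Dividing by \<open>t\<close> costs exactly one order; this equivalence is the exchange
  rate between Schur steps and orders of vanishing.\<close>

lemma small_Suc_scale: "small (Suc N) (\<lambda>t. t *\<^sub>R f t) \<longleftrightarrow> small N f"
proof -
  have "eventually (\<lambda>t::real. (t *\<^sub>R f t) /\<^sub>R t ^ Suc N = f t /\<^sub>R t ^ N)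
      (at_right 0)"
    using eventually_at_right_0 by eventually_elim (simp add: field_simps)
  then have "eventually (\<lambda>t::real. f t /\<^sub>R t ^ N = (t *\<^sub>R f t) /\<^sub>R t ^ Suc N)
      (at_right 0)"
    by eventually_elim simp
  from Zfun_ssubst[OF this] Zfun_ssubst[OF \<open>eventually (\<lambda>t::real. (t *\<^sub>R f t)
      /\<^sub>R t ^ Suc N = f t /\<^sub>R t ^ N) (at_right 0)\<close>]
  show ?thesis
    unfolding small_def by blast
qed

lemma small_of_norm_le_power:
  assumes "eventually (\<lambda>t. norm (f t) \<le> C * t ^ Suc N) (at_right 0)"
  shows "small N f"
  unfolding small_def
proof (rule ZfunI)
  fix e :: real
  assume e: "0 < e"
  \<comment> \<open>Makes the divisor in \<open>e / D\<close> positive even if \<open>C\<close> is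
    not.\<close>
  define D where "D = \<bar>C\<bar> + 1"
  have D: "0 < D" "C \<le> D"
    by (simp_all add: D_def)
  have "eventually (\<lambda>t::real. t < e / D) (at_right 0)"
    using e D by (intro order_tendstoD(2)[OF tendsto_ident_at]) simp
  with assms eventually_at_right_0 show "eventually (\<lambda>t. norm (f t /\<^sub>R t ^ N) < e) (at_right 0)"
  proof eventually_elim
    case (elim t)
    have "norm (f t) \<le> D * t * t ^ N"
      using elim D by (smt (verit) mult.assoc mult_right_mono power_Suc zero_le_power)
    also have "\<dots> < e * t ^ N"
      using elim D by (simp add: field_simps)
    finally show ?case
      using elim by (simp add: field_simps)
  qed
qed

lemma small_0_scale: "bdd f \<Longrightarrow> small 0 (\<lambda>t. t *\<^sub>R f t)"
proof -
  assume "bdd f"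
  then obtain A where "eventually (\<lambda>t. norm (f t) \<le> A) (at_right 0)"
    by (auto simp: Bfun_def)
  with eventually_at_right_0 have "eventually (\<lambda>t. norm (t *\<^sub>R f t) \<le> A * t ^ Suc 0)
      (at_right 0)"
    by eventually_elim simp
  then show ?thesis
    by (rule small_of_norm_le_power)
qed

lemma small_SucD: "small (Suc N) f \<Longrightarrow> small N f"
proof -
  assume f: "small (Suc N) f"
  define g where "g t = f t /\<^sub>R t ^ Suc N" for t
  have "eventually (\<lambda>t. norm (g t) < 1) (at_right 0)"
    using f by (intro ZfunD) (simp_all add: small_def g_def)
  with eventually_at_right_0 have "eventually (\<lambda>t. norm (f t) \<le> 1 * t ^ Suc N) (at_right 0)"
    by eventually_elim (simp add: g_def field_simps)
  then show "small N f"
    by (rule small_of_norm_le_power)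
qed

lemma small_mono: "small N f \<Longrightarrow> M \<le> N \<Longrightarrow> small M f"
  by (induction N arbitrary: M) (auto simp: le_Suc_eq dest: small_SucD)

lemma small_scale: "small N f \<Longrightarrow> small N (\<lambda>t. t *\<^sub>R f t)"
  by (rule small_SucD) (simp add: small_Suc_scale)

lemma small_const_iff: "small 0 (\<lambda>_. c) \<longleftrightarrow> c = 0"
  using tendsto_const_iff[OF trivial_limit_at_right_real, of c 0 0] by (simp add: small_def tendsto_Zfun_iff)

lemma oeq_refl [simp, intro]: "oeq N f f"
  by (simp add: oeq_def small_def Zfun_zero)

lemma oeq_sym: "oeq N f g \<Longrightarrow> oeq N g f"
  unfolding oeq_def by (drule small_uminus) simp

lemma oeq_trans [trans]: "oeq N f g \<Longrightarrow> oeq N g h \<Longrightarrow> oeq N f h"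
  unfolding oeq_def by (drule (1) small_add) simp

lemma oeq_add: "oeq N f f' \<Longrightarrow> oeq N g g' \<Longrightarrow> oeq N (\<lambda>t. f t + g t)
    (\<lambda>t. f' t + g' t)"
  unfolding oeq_def by (drule (1) small_add) (simp add: algebra_simps)

lemma oeq_diff: "oeq N f f' \<Longrightarrow> oeq N g g' \<Longrightarrow> oeq N (\<lambda>t. f t - g
    t) (\<lambda>t. f' t - g' t)"
  unfolding oeq_def by (drule (1) small_diff) (simp add: algebra_simps)

lemma oeq_mult:
  fixes f g :: "real \<Rightarrow> 'a::real_normed_algebra"
  assumes "oeq N f f'" "oeq N g g'" "bdd f" "bdd g'"
  shows "oeq N (\<lambda>t. f t * g t) (\<lambda>t. f' t * g' t)"
proof -
  have "small N (\<lambda>t. f t * (g t - g' t) + (f t - f' t) * g' t)"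
    using assms unfolding oeq_def by (intro small_add small_mult_left small_mult_right)
  then show ?thesis
    by (simp add: oeq_def algebra_simps)
qed

lemma oeq_scale: "oeq N f g \<Longrightarrow> oeq N (\<lambda>t. t *\<^sub>R f t) (\<lambda>t. t
    *\<^sub>R g t)"
  unfolding oeq_def by (drule small_scale) (simp add: algebra_simps)

lemma oeq_Suc_scale: "oeq (Suc N) (\<lambda>t. t *\<^sub>R f t) (\<lambda>t. t *\<^sub>R g t)
    \<longleftrightarrow> oeq N f g"
  unfolding oeq_def using small_Suc_scale[of N "\<lambda>t. f t - g t"] by (simp add: algebra_simps)

lemma oeq_mono: "oeq N f g \<Longrightarrow> M \<le> N \<Longrightarrow> oeq M f g"
  unfolding oeq_def by (rule small_mono)

lemma oeq_cong:
  assumes "oeq N f g" "eventually (\<lambda>t. f t = f' t) (at_right 0)" "eventually (\<lambda>t. g t =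
      g' t) (at_right 0)"
  shows "oeq N f' g'"
  using assms(1) unfolding oeq_def
  by (rule small_cong) (use assms(2,3) in \<open>eventually_elim, simp\<close>)

lemma oeq_eventually: "eventually (\<lambda>t. f t = g t) (at_right 0) \<Longrightarrow> oeq N f g"
  by (rule oeq_cong[of N g g]) (auto simp: eq_commute)

lemma oeq_const_iff: "oeq 0 (\<lambda>_. c) (\<lambda>_. d) \<longleftrightarrow> c = d"
  by (simp add: oeq_def small_const_iff)

lemma oeq_0_scale:
  assumes "bdd f"
  shows "oeq 0 (\<lambda>t. c + t *\<^sub>R f t) (\<lambda>_. c)"
  using small_0_scale[OF assms] by (simp add: oeq_def)

text \<open>Bounded inverses, and not just invertibility at each \<open>t\<close>, ensure that
  cancelling \<open>f\<close> preserves \<open>o(t^N)\<close>.\<close>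

definition unit_near :: "(real \<Rightarrow> 'a::real_normed_algebra_1) \<Rightarrow> bool" where
  "unit_near f \<longleftrightarrow> eventually (\<lambda>t. f t * rinv (f t) = 1 \<and> rinv (f t) * f
      t = 1) (at_right 0)
     \<and> bdd (\<lambda>t. rinv (f t))"

lemma unit_near_bdd [bdd_intros]: "unit_near f \<Longrightarrow> bdd (\<lambda>t. rinv (f t))"
  by (simp add: unit_near_def)

lemma unit_near_eventually:
  "unit_near f \<Longrightarrow> eventually (\<lambda>t. f t * rinv (f t) = 1 \<and> rinv (f t) * f t =
      1) (at_right 0)"
  by (simp add: unit_near_def)

text \<open>Near 0 one has \<open>f t = c * (1 - e t)\<close> with \<open>e t\<close> tending to 0;
  once \<open>norm (e t) < 1/2\<close>, the inverse exists and has norm at most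
  \<open>2 * norm d\<close>.\<close>

lemma unit_nearI:
  fixes f :: "real \<Rightarrow> 'a::{real_normed_algebra_1,banach}"
  assumes f: "oeq 0 f (\<lambda>_. c)" and c: "c * d = 1" "d * c = 1"
  shows "unit_near f"
proof -
  define e where "e t = - (d * (f t - c))" for t
  have fe: "f t = c * (1 - e t)" for t
    by (simp add: e_def algebra_simps mult.assoc[symmetric] c)
  have "small 0 (\<lambda>t. - (d * (f t - c)))"
    using f unfolding oeq_def by (intro small_uminus small_mult_left bdd_const)
  then have "eventually (\<lambda>t. norm (e t) < 1 / 2) (at_right 0)"
    unfolding small_def e_def[symmetric] by (drule_tac ZfunD[where r = "1/2"]) auto
  then have ev: "eventually (\<lambda>t. f t * rinv (f t) = 1 \<and> rinv (f t) * f t = 1 \<and> norm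
      (rinv (f t)) \<le> 2 * norm d) (at_right 0)"
  proof eventually_elim
    case (elim t)
    then have lt: "norm (e t) < 1"
      by simp
    define k where "k = rinv (1 - e t)"
    have k: "(1 - e t) * k = 1" "k * (1 - e t) = 1"
      unfolding k_def by (fact one_minus_invertible[OF lt])+
    have "norm k \<le> 1 / (1 - norm (e t))"
      unfolding k_def by (rule one_minus_invertible[OF lt])
    also have "\<dots> \<le> 2"
      using elim by (simp add: field_simps)
    finally have nk: "norm k \<le> 2" .
    have 1: "f t * (k * d) = 1"
      using k(1) c(1) by (simp add: fe mult.assoc) (simp add: mult.assoc[symmetric])
    have 2: "k * d * f t = 1"
      using k(2) c(2) by (simp add: fe mult.assoc) (simp add: mult.assoc[symmetric])
    have "rinv (f t) = k * d"
      using 1 2 by (rule rinv_eqI)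
    moreover have "norm (k * d) \<le> 2 * norm d"
      by (rule order_trans[OF norm_mult_ineq]) (simp add: nk mult_right_mono)
    ultimately show ?case
      using 1 2 by simp
  qed
  show ?thesis
    unfolding unit_near_def
  proof
    show "eventually (\<lambda>t. f t * rinv (f t) = 1 \<and> rinv (f t) * f t = 1) (at_right 0)"
      using ev by eventually_elim simp
    show "bdd (\<lambda>t. rinv (f t))"
      by (rule BfunI[of _ "2 * norm d"]) (use ev in \<open>eventually_elim, simp\<close>)
  qed
qed

lemma unit_near_one_plus:
  fixes f :: "real \<Rightarrow> 'a::{real_normed_algebra_1,banach}"
  assumes "bdd f"
  shows "unit_near (\<lambda>t. 1 + t *\<^sub>R f t)"
  by (rule unit_nearI[OF oeq_0_scale[OF assms], of 1]) simp_all

text \<open>The factors \<open>f\<close> and \<open>g\<close> need agree only to the order of the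
  conclusion, since the bounded \<open>y\<close> absorbs their difference. Only \<open>f\<close> is
  assumed to be a unit, which is why one invertible \<open>h(0)\<close> suffices in (i).\<close>

lemma oeq_cancel_left:
  assumes fx: "oeq N (\<lambda>t. f t * x t) (\<lambda>t. g t * y t)" and fg: "oeq N f g"
    and f: "unit_near f" and y: "bdd y"
  shows "oeq N x y"
proof -
  have "oeq N (\<lambda>t. f t * x t) (\<lambda>t. f t * y t)"
  proof (rule oeq_trans[OF fx])
    show "oeq N (\<lambda>t. g t * y t) (\<lambda>t. f t * y t)"
      using fg y oeq_sym[of N f g] small_mult_right[of N "\<lambda>t. g t - f t" y]
      by (simp add: oeq_def left_diff_distrib)
  qed
  then have "small N (\<lambda>t. f t * (x t - y t))"
    by (simp add: oeq_def right_diff_distrib)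
  then have "small N (\<lambda>t. rinv (f t) * (f t * (x t - y t)))"
    by (rule small_mult_left[OF unit_near_bdd[OF f]])
  then show ?thesis
    unfolding oeq_def
    by (rule small_cong) (use unit_near_eventually[OF f] in \<open>eventually_elim, simp add:
        mult.assoc[symmetric]\<close>)
qed

lemma oeq_cancel_right:
  assumes fx: "oeq N (\<lambda>t. x t * f t) (\<lambda>t. y t * g t)" and fg: "oeq N f g"
    and f: "unit_near f" and y: "bdd y"
  shows "oeq N x y"
proof -
  have "oeq N (\<lambda>t. x t * f t) (\<lambda>t. y t * f t)"
  proof (rule oeq_trans[OF fx])
    show "oeq N (\<lambda>t. y t * g t) (\<lambda>t. y t * f t)"
      using fg y oeq_sym[of N f g] small_mult_left[of y N "\<lambda>t. g t - f t"]
      by (simp add: oeq_def right_diff_distrib)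
  qed
  then have "small N (\<lambda>t. (x t - y t) * f t)"
    by (simp add: oeq_def left_diff_distrib)
  then have "small N (\<lambda>t. (x t - y t) * f t * rinv (f t))"
    by (rule small_mult_right[OF _ unit_near_bdd[OF f]])
  then show ?thesis
    unfolding oeq_def
    by (rule small_cong) (use unit_near_eventually[OF f] in \<open>eventually_elim, simp add:
        mult.assoc\<close>)
qed

lemma oeq_rinv:
  assumes "oeq N f g" "unit_near f" "unit_near g"
  shows "oeq N (\<lambda>t. rinv (f t)) (\<lambda>t. rinv (g t))"
proof (rule oeq_cancel_left[OF _ assms(1,2) unit_near_bdd[OF assms(3)]])
  show "oeq N (\<lambda>t. f t * rinv (f t)) (\<lambda>t. g t * rinv (g t))"
    by (rule oeq_eventually)
       (use unit_near_eventually[OF assms(2)] unit_near_eventually[OF assms(3)] in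
           \<open>eventually_elim, simp\<close>)
qed

subsection \<open>The matrix Schur algorithm\<close>

definition cay :: "'m::finite cmatrix \<Rightarrow> 'm cmatrix \<Rightarrow> 'm cmatrix" where
  "cay a X = X * rinv (1 - a * X)"

text \<open>One inverse step of the Schur algorithm; for scalars it is
  \<open>(X - cnj a) / (1 - a * X)\<close>. Its value at \<open>X = 0\<close> is
  \<open>- adj a\<close>, and \<open>cay\<close> isolates the part that vanishes there.\<close>

definition mob :: "'m::finite cmatrix \<Rightarrow> 'm cmatrix \<Rightarrow> 'm cmatrix" where
  "mob a X = - adj a + defect a * cay a X * defect (adj a)"

lemma unit_near_cay: "bdd X \<Longrightarrow> unit_near (\<lambda>t. 1 - a * (t *\<^sub>R X t))" for a
    :: "'m::finite cmatrix"
  using unit_near_one_plus[of "\<lambda>t. - (a * X t)"] by (simp add: bdd_intros)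

lemma bdd_cay [bdd_intros]: "bdd X \<Longrightarrow> bdd (\<lambda>t. cay a (t *\<^sub>R X t))"
  unfolding cay_def by (intro bdd_intros unit_near_cay)

lemma bdd_mob [bdd_intros]: "bdd X \<Longrightarrow> bdd (\<lambda>t. mob a (t *\<^sub>R X t))"
  unfolding mob_def by (intro bdd_intros)

lemma cay_identities:
  assumes "(1 - a * X) * rinv (1 - a * X) = 1" "rinv (1 - a * X) * (1 - a * X) = 1"
  shows "cay a X * (1 - a * X) = X" "(1 - X * a) * cay a X = X"
proof -
  show "cay a X * (1 - a * X) = X"
    by (simp add: cay_def mult.assoc assms)
  have "(1 - X * a) * cay a X = X * ((1 - a * X) * rinv (1 - a * X))"
    by (simp add: cay_def algebra_simps)
  then show "(1 - X * a) * cay a X = X"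
    by (simp add: assms)
qed

lemma eventually_cay_identities:
  assumes "bdd X"
  shows "eventually (\<lambda>t. cay a (t *\<^sub>R X t) * (1 - a * (t *\<^sub>R X t)) = t *\<^sub>R X
      t \<and>
    (1 - t *\<^sub>R X t * a) * cay a (t *\<^sub>R X t) = t *\<^sub>R X t) (at_right 0)"
  using unit_near_eventually[OF unit_near_cay[OF assms, of a]]
  by eventually_elim (use cay_identities in blast)

lemma oeq_0_mob:
  assumes "bdd X"
  shows "oeq 0 (\<lambda>t. mob a (t *\<^sub>R X t)) (\<lambda>_. - adj a)"
proof -
  have "mob a (t *\<^sub>R X t) = - adj a + t *\<^sub>R (defect a * (X t * rinv (1 - a * (t *\<^sub>R X
      t))) * defect (adj a))" for t
    by (simp add: mob_def cay_def)
  then show ?thesis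
    by (simp only:) (intro oeq_0_scale bdd_intros unit_near_cay assms)
qed

lemma oeq_mob:
  assumes "bdd X1" "bdd X2" "oeq N (\<lambda>t. t *\<^sub>R X1 t) (\<lambda>t. t *\<^sub>R X2 t)"
  shows "oeq N (\<lambda>t. mob a (t *\<^sub>R X1 t)) (\<lambda>t. mob a (t *\<^sub>R X2 t))"
  unfolding mob_def cay_def
  using assms
  by (intro oeq_add oeq_mult oeq_diff oeq_rinv oeq_refl bdd_intros unit_near_cay)

text \<open>At \<open>t = 0\<close> each side reduces to \<open>- adj a\<close>, which gives the
  coefficient. After the defects are inverted, multiplying the difference of the two
  \<open>cay\<close> terms by \<open>1 - x1 * a\<close> on the left and \<open>1 - a * x2\<close> on
  the right leaves exactly \<open>x1 - x2\<close>.\<close>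

lemma mob_inject:
  assumes a: "norm a1 < 1" "norm a2 < 1" and X: "bdd X1" "bdd X2"
    and eq: "oeq N (\<lambda>t. mob a1 (t *\<^sub>R X1 t)) (\<lambda>t. mob a2 (t *\<^sub>R X2 t))"
  shows "a1 = a2" and "oeq N (\<lambda>t. t *\<^sub>R X1 t) (\<lambda>t. t *\<^sub>R X2 t)"
proof -
  have "oeq 0 (\<lambda>_. - adj a1) (\<lambda>_. - adj a2)"
    using oeq_trans[OF oeq_trans[OF oeq_sym[OF oeq_0_mob[OF X(1), of a1]] oeq_mono[OF eq]]
        oeq_0_mob[OF X(2), of a2]]
    by simp
  then have "adj a1 = adj a2"
    by (simp add: oeq_const_iff)
  then show a12: "a1 = a2"
    by (metis adj_simps(1))
  define a where "a = a1"
  define Y1 Y2 where Y: "Y1 t = cay a (t *\<^sub>R X1 t)" "Y2 t = cay a (t *\<^sub>R X2 t)" for t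
  have na: "norm a < 1" "norm (adj a) < 1"
    by (simp_all add: a_def a)
  have s0: "small N (\<lambda>t. defect a * (Y1 t - Y2 t) * defect (adj a))"
    using eq by (simp add: oeq_def mob_def Y a12 a_def algebra_simps)
  have "small N (\<lambda>t. (1 - t *\<^sub>R X1 t * a) * (rinv (defect a) *
      (defect a * (Y1 t - Y2 t) * defect (adj a)) * rinv (defect (adj a))) * (1 - a * (t *\<^sub>R X2 t)))"
    by (rule small_mult_right[OF small_mult_left[OF _ small_mult_right[OF small_mult_left[OF bdd_const
        s0] bdd_const]]])
       (intro bdd_intros X)+
  moreover have "rinv (defect a) * (defect a * D * defect (adj a)) * rinv (defect (adj a)) = D" for D
  proof -
    have "rinv (defect a) * (defect a * D * defect (adj a)) * rinv (defect (adj a))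
      = (rinv (defect a) * defect a) * D * (defect (adj a) * rinv (defect (adj a)))"
      by (simp only: mult.assoc)
    then show ?thesis
      by (simp add: defect_inverse na)
  qed
  ultimately have s: "small N (\<lambda>t. (1 - t *\<^sub>R X1 t * a) * (Y1 t - Y2 t) * (1 - a * (t
      *\<^sub>R X2 t)))"
    by simp
  show "oeq N (\<lambda>t. t *\<^sub>R X1 t) (\<lambda>t. t *\<^sub>R X2 t)"
    unfolding oeq_def
  proof (rule small_cong[OF s])
    show "eventually (\<lambda>t. (1 - t *\<^sub>R X1 t * a) * (Y1 t - Y2 t) * (1 - a * (t *\<^sub>R X2 t))
        = t *\<^sub>R X1 t - t *\<^sub>R X2 t) (at_right 0)"
      using eventually_cay_identities[OF X(1), of a] eventually_cay_identities[OF X(2), of a]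
    proof eventually_elim
      case (elim t)
      define x1 x2 where x: "x1 = t *\<^sub>R X1 t" "x2 = t *\<^sub>R X2 t"
      have "(1 - x1 * a) * (Y1 t - Y2 t) * (1 - a * x2)
          = ((1 - x1 * a) * Y1 t) * (1 - a * x2) - (1 - x1 * a) * (Y2 t * (1 - a * x2))"
        by (simp add: algebra_simps)
      also have "\<dots> = x1 * (1 - a * x2) - (1 - x1 * a) * x2"
        using elim by (simp add: Y x)
      also have "\<dots> = x1 - x2"
        by (simp add: algebra_simps)
      finally show ?case
        by (simp only: x)
    qed
  qed
qed

text \<open>The Schur function with parameters \<open>c 0, c 1, \<dots>\<close>, cut off after
    \<open>j\<close> steps.\<close>

primrec schur :: "nat \<Rightarrow> (nat \<Rightarrow> 'm::finite cmatrix) \<Rightarrow> real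
    \<Rightarrow> 'm cmatrix" where
  "schur 0 c t = 0"
| "schur (Suc j) c t = mob (c 0) (t *\<^sub>R schur j (\<lambda>i. c (Suc i)) t)"

lemma bdd_schur [bdd_intros]: "bdd (schur j c)"
proof (induction j arbitrary: c)
  case 0
  have "schur 0 c = (\<lambda>_. 0)" by (simp add: fun_eq_iff)
  then show ?case by simp
next
  case (Suc j)
  have "schur (Suc j) c = (\<lambda>t. mob (c 0) (t *\<^sub>R schur j (\<lambda>i. c (Suc i)) t))"
    by (simp add: fun_eq_iff)
  then show ?case
    by (simp add: bdd_mob Suc)
qed

text \<open>Each Schur step reads one coefficient off the constant term and leaves \<open>t\<close>
  times the next function, hence one order less. Order \<open>N\<close> therefore gives
  \<open>N + 1\<close> coefficients, all within the cut-off because \<open>N < j\<close>.\<close>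

lemma schur_inject:
  assumes "\<And>i. norm (c1 i) < 1" "\<And>i. norm (c2 i) < 1"
    and "oeq N (schur j c1) (schur j c2)" and "N < j" and "i \<le> N"
  shows "c1 i = c2 i"
  using assms
proof (induction N arbitrary: j c1 c2 i)
  case 0
  then obtain j' where j: "j = Suc j'"
    by (cases j) auto
  have "oeq 0 (\<lambda>t. mob (c1 0) (t *\<^sub>R schur j' (\<lambda>i. c1 (Suc i)) t)) (\<lambda>t.
      mob (c2 0) (t *\<^sub>R schur j' (\<lambda>i. c2 (Suc i)) t))"
    using "0.prems"(3) by (simp add: j oeq_def)
  from mob_inject(1)[OF 0(1,2) bdd_schur bdd_schur this] show ?case
    using 0 by simp
next
  case (Suc N)
  then obtain j' where j: "j = Suc j'"
    by (cases j) auto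
  have eq: "oeq (Suc N) (\<lambda>t. mob (c1 0) (t *\<^sub>R schur j' (\<lambda>i. c1 (Suc i)) t))
      (\<lambda>t. mob (c2 0) (t *\<^sub>R schur j' (\<lambda>i. c2 (Suc i)) t))"
    using Suc.prems(3) by (simp add: j oeq_def)
  note inj = mob_inject[OF Suc.prems(1,2) bdd_schur bdd_schur eq]
  show ?case
  proof (cases i)
    case 0
    with inj(1) show ?thesis by simp
  next
    case (Suc i')
    have "c1 (Suc i') = c2 (Suc i')"
      using Suc.prems Suc j inj(2)[unfolded oeq_Suc_scale] by (intro Suc.IH[of "\<lambda>i. c1 (Suc i)"
          "\<lambda>i. c2 (Suc i)" j']) auto
    with Suc show ?thesis by simp
  qed
qed

text \<open>\<open>(x, q)\<close> is the adjoint of the block \<open>Theta a\<close> applied to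
  \<open>(y, p)\<close>. If \<open>p = X * q\<close>, then \<open>x = mob a X * y\<close>; the
  identity measures how an error in the first relation enters the second.\<close>

lemma mob_step:
  fixes a X x y p q :: "'m::finite cmatrix"
  assumes inv: "rinv (1 - a * X) * (1 - a * X) = 1"
    and x: "x = - adj a * y + defect a * p" and q: "q = defect (adj a) * y + a * p"
  shows "x - mob a X * y = defect a * (1 + cay a X * a) * (p - X * q)"
proof -
  define e where "e = p - X * q"
  have p: "p = X * q + e"
    by (simp add: e_def)
  have "(1 - a * X) * q = defect (adj a) * y + a * e"
    by (simp add: e_def q algebra_simps)
  then have "rinv (1 - a * X) * ((1 - a * X) * q) = rinv (1 - a * X) * (defect (adj a) * y + a * e)"
    by simp
  then have q': "q = rinv (1 - a * X) * (defect (adj a) * y + a * e)"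
    by (simp only: mult.assoc[symmetric] inv) simp
  have "x - mob a X * y = defect a * (X * q + e) - defect a * cay a X * defect (adj a) * y"
    unfolding x mob_def p[symmetric] by (simp add: algebra_simps)
  also have "X * q = cay a X * (defect (adj a) * y + a * e)"
    by (subst q') (simp add: cay_def mult.assoc)
  also have "defect a * (cay a X * (defect (adj a) * y + a * e) + e) - defect a * cay a X * defect (adj a) * y
      = defect a * (1 + cay a X * a) * e"
    by (simp add: algebra_simps)
  finally show ?thesis
    by (simp add: e_def)
qed

text \<open>Errors are propagated by a bounded factor, and every second step gains a factor
    \<open>t\<close>.\<close>

lemma schur_approx_bound:
  fixes X Y :: "nat \<Rightarrow> real \<Rightarrow> 'm::finite cmatrix"
  assumes X: "\<And>i. bdd (X i)" and Y: "\<And>i. bdd (Y i)"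
    and even: "\<And>i. even (i + p) \<Longrightarrow> eventually (\<lambda>t.
       X i t = - adj (c i) * Y i t + defect (c i) * (t *\<^sub>R X (Suc i) t) \<and>
       Y (Suc i) t = defect (adj (c i)) * Y i t + c i * (t *\<^sub>R X (Suc i) t)) (at_right 0)"
    and odd: "\<And>i. odd (i + p) \<Longrightarrow> eventually (\<lambda>t.
       X i t = - adj (c i) * Y i t + defect (c i) * X (Suc i) t \<and>
       Y (Suc i) t = t *\<^sub>R (defect (adj (c i)) * Y i t + c i * X (Suc i) t)) (at_right 0)"
    and j: "2 * N \<le> j"
  shows "\<exists>C. eventually (\<lambda>t. norm (X i t - schur j (\<lambda>l. c (i + l)) t * Y i t)
      \<le> C * t ^ N) (at_right 0)"
  using j
proof (induction N arbitrary: i j)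
  case 0
  have "bdd (\<lambda>t. X i t - schur j (\<lambda>l. c (i + l)) t * Y i t)"
    by (intro bdd_intros X Y)
  then show ?case
    by (auto simp: Bfun_def)
next
  case (Suc N)
  define E where "E j i t = X i t - schur j (\<lambda>l. c (i + l)) t * Y i t" for i j t
  have step: "\<exists>C>0. eventually (\<lambda>t. norm (E (Suc j) i t) \<le> C * (if even (i + p)
      then t else 1) * norm (E j (Suc i) t)) (at_right 0)" for i j
  proof -
    define F where "F = schur j (\<lambda>l. c (Suc i + l))"
    have F: "bdd F"
      unfolding F_def by (rule bdd_schur)
    define B where "B t = defect (c i) * (1 + cay (c i) (t *\<^sub>R F t) * c i)" for t
    have "bdd B"
      unfolding B_def by (intro bdd_intros F)
    then obtain C where C: "C > 0" and evC: "eventually (\<lambda>t. norm (B t) \<le> C) (at_right 0)"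
      by (auto simp: Bfun_def)
    note u = unit_near_eventually[OF unit_near_cay[OF F, of "c i"]]
    have Suc_schur: "schur (Suc j) (\<lambda>l. c (i + l)) t = mob (c i) (t *\<^sub>R F t)" for t
      by (simp add: F_def)
    have "eventually (\<lambda>t. norm (E (Suc j) i t) \<le> C * (if even (i + p) then t else 1) * norm
        (E j (Suc i) t)) (at_right 0)"
    proof (cases "even (i + p)")
      case True
      from even[OF True] u evC eventually_at_right_0 show ?thesis
      proof eventually_elim
        case (elim t)
        have "E (Suc j) i t = B t * (t *\<^sub>R X (Suc i) t - t *\<^sub>R F t * Y (Suc i) t)"
          unfolding E_def Suc_schur B_def using elim by (intro mob_step) auto
        also have "\<dots> = t *\<^sub>R (B t * E j (Suc i) t)"
          by (simp add: E_def F_def algebra_simps)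
        finally have "norm (E (Suc j) i t) \<le> t * (norm (B t) * norm (E j (Suc i) t))"
          using elim norm_mult_ineq[of "B t" "E j (Suc i) t"] by simp
        also have "\<dots> \<le> t * (C * norm (E j (Suc i) t))"
          using elim by (intro mult_left_mono mult_right_mono) auto
        finally show ?case
          using True by (simp add: mult_ac)
      qed
    next
      case False
      from odd[OF False] u evC show ?thesis
      proof eventually_elim
        case (elim t)
        have "E (Suc j) i t = B t * (X (Suc i) t - t *\<^sub>R F t * (defect (adj (c i)) * Y i t + c i
            * X (Suc i) t))"
          unfolding E_def Suc_schur B_def using elim by (intro mob_step) auto
        also have "\<dots> = B t * E j (Suc i) t"
          using elim by (simp add: E_def F_def)
        finally have "norm (E (Suc j) i t) \<le> norm (B t) * norm (E j (Suc i) t)"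
          using norm_mult_ineq[of "B t" "E j (Suc i) t"] by simp
        also have "\<dots> \<le> C * norm (E j (Suc i) t)"
          using elim by (intro mult_right_mono) auto
        finally show ?case
          using False by simp
      qed
    qed
    with C show ?thesis
      by blast
  qed
  obtain j' where j': "j = Suc (Suc j')" "2 * N \<le> j'"
    using Suc.prems by (cases j; cases "j - 1") auto
  obtain C1 where C1: "C1 > 0" "eventually (\<lambda>t. norm (E (Suc (Suc j')) i t) \<le> C1 * (if even
      (i + p) then t else 1) * norm (E (Suc j') (Suc i) t)) (at_right 0)"
    using step by blast
  obtain C2 where C2: "C2 > 0" "eventually (\<lambda>t. norm (E (Suc j') (Suc i) t) \<le> C2 * (if even
      (Suc i + p) then t else 1) * norm (E j' (Suc (Suc i)) t)) (at_right 0)"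
    using step by blast
  obtain C3 where C3: "eventually (\<lambda>t. norm (E j' (Suc (Suc i)) t) \<le> C3 * t ^ N) (at_right 0)"
    using Suc.IH[OF j'(2)] unfolding E_def by blast
  from C1(2) C2(2) C3 eventually_at_right_0
  have "eventually (\<lambda>t. norm (E j i t) \<le> (C1 * C2 * C3) * t ^ Suc N) (at_right 0)"
  proof eventually_elim
    case (elim t)
    define f1 where "f1 = (if even (i + p) then t else 1)"
    define f2 where "f2 = (if even (Suc i + p) then t else 1)"
    have f: "f1 * f2 = t" "0 < f1" "0 < f2"
      using elim by (auto simp: f1_def f2_def)
    have "norm (E j i t) \<le> C1 * f1 * norm (E (Suc j') (Suc i) t)"
      using elim by (simp add: j' f1_def)
    also have "\<dots> \<le> C1 * f1 * (C2 * f2 * norm (E j' (Suc (Suc i)) t))"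
      using elim(2) C1 f unfolding f2_def[symmetric] by (intro mult_left_mono) auto
    also have "\<dots> \<le> C1 * f1 * (C2 * f2 * (C3 * t ^ N))"
      using elim C1 C2 f by (intro mult_left_mono) auto
    also have "\<dots> = (C1 * C2 * C3) * ((f1 * f2) * t ^ N)"
      by (simp add: mult_ac)
    finally show ?case
      by (simp add: f)
  qed
  then show ?case
    unfolding E_def by blast
qed

text \<open>\<open>2 * N + 2\<close> steps collect \<open>N + 1\<close> factors \<open>t\<close>, so
  the error is of the size of \<open>t ^ Suc N\<close> and thus \<open>o(t^N)\<close>.\<close>

lemma schur_approx:
  fixes X Y :: "nat \<Rightarrow> real \<Rightarrow> 'm::finite cmatrix"
  assumes X: "\<And>i. bdd (X i)" and Y: "\<And>i. bdd (Y i)"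
    and even: "\<And>i. even (i + p) \<Longrightarrow> eventually (\<lambda>t.
       X i t = - adj (c i) * Y i t + defect (c i) * (t *\<^sub>R X (Suc i) t) \<and>
       Y (Suc i) t = defect (adj (c i)) * Y i t + c i * (t *\<^sub>R X (Suc i) t)) (at_right 0)"
    and odd: "\<And>i. odd (i + p) \<Longrightarrow> eventually (\<lambda>t.
       X i t = - adj (c i) * Y i t + defect (c i) * X (Suc i) t \<and>
       Y (Suc i) t = t *\<^sub>R (defect (adj (c i)) * Y i t + c i * X (Suc i) t)) (at_right 0)"
    and j: "2 * N + 2 \<le> j"
  shows "oeq N (X 0) (\<lambda>t. schur j c t * Y 0 t)"
proof -
  have "\<exists>C. eventually (\<lambda>t. norm (X 0 t - schur j (\<lambda>l. c (0 + l)) t * Y 0 t)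
      \<le> C * t ^ Suc N) (at_right 0)"
    by (rule schur_approx_bound[where p = p]) ((fact X Y even odd)+, use j in simp)
  then show ?thesis
    unfolding oeq_def by (auto intro: small_of_norm_le_power)
qed

subsection \<open>Green's matrices\<close>

definition schur_right :: "(int \<Rightarrow> 'm::finite cmatrix) \<Rightarrow> nat \<Rightarrow> int
    \<Rightarrow> real \<Rightarrow> 'm cmatrix" where
  "schur_right \<alpha> j n = schur j (\<lambda>i. \<alpha> (n + int i))"

text \<open>Read from right to left, an adjoint block has its two coordinates exchanged; this is
  again an adjoint block, with \<open>- adj a\<close> in place of \<open>a\<close>, whence the
  parameters.\<close>

definition schur_left :: "(int \<Rightarrow> 'm::finite cmatrix) \<Rightarrow> nat \<Rightarrow> int
    \<Rightarrow> real \<Rightarrow> 'm cmatrix" where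
  "schur_left \<alpha> j n = schur j (\<lambda>i. - adj (\<alpha> (n - int i)))"

lemma schur_right_Suc: "schur_right \<alpha> (Suc j) n t = mob (\<alpha> n) (t *\<^sub>R schur_right
    \<alpha> j (n + 1) t)"
  by (simp add: schur_right_def algebra_simps)

lemma schur_left_Suc: "schur_left \<alpha> (Suc j) n t = mob (- adj (\<alpha> n)) (t *\<^sub>R
    schur_left \<alpha> j (n - 1) t)"
  by (simp add: schur_left_def algebra_simps)

lemma bdd_schur_right [bdd_intros]: "bdd (schur_right \<alpha> j n)"
  by (simp add: schur_right_def bdd_schur)

lemma bdd_schur_left [bdd_intros]: "bdd (schur_left \<alpha> j n)"
  by (simp add: schur_left_def bdd_schur)

text \<open>Column \<open>k\<close> of the Green's matrix, as the solution \<open>u\<close> of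
    \<open>(U - t) u = \<delta>\<^sub>k\<close>, and \<open>v = W u\<close>.
  The equations are \<open>u = W\<^sup>* v\<close> and \<open>v = V\<^sup>* (t u +
      \<delta>\<^sub>k)\<close>.\<close>

definition forced :: "int \<Rightarrow> (int \<Rightarrow> real \<Rightarrow> 'm::finite cmatrix)
    \<Rightarrow> int \<Rightarrow> real \<Rightarrow> 'm cmatrix" where
  "forced k u n t = t *\<^sub>R u n t + (if n = k then 1 else 0)"

text \<open>The equations are required on an interval that contains \<open>t = 0\<close>, so that
  the entry \<open>h\<close> at 0 can be evaluated exactly; boundedness starts the approximation by
  truncated Schur functions. The endpoint \<open>1/20\<close> comes from the resolvent
  estimate.\<close>

locale green_column =
  fixes \<alpha> :: "int \<Rightarrow> 'm::finite cmatrix" and k :: int and u v :: "int \<Rightarrow>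
      real \<Rightarrow> 'm cmatrix"
  assumes contr: "\<And>n. norm (\<alpha> n) < 1"
    and bdd_u: "\<And>n. bdd (u n)" and bdd_v: "\<And>n. bdd (v n)"
    and u_left: "\<And>n t. odd n \<Longrightarrow> t \<in> {0..1/20} \<Longrightarrow> u (n - 1) t = -
        adj (\<alpha> n) * v (n - 1) t + defect (\<alpha> n) * v n t"
    and u_right: "\<And>n t. odd n \<Longrightarrow> t \<in> {0..1/20} \<Longrightarrow> u n t = defect
        (adj (\<alpha> n)) * v (n - 1) t + \<alpha> n * v n t"
    and v_left: "\<And>n t. even n \<Longrightarrow> t \<in> {0..1/20} \<Longrightarrow> v (n - 1) t =
        - adj (\<alpha> n) * forced k u (n - 1) t + defect (\<alpha> n) * forced k u n t"
    and v_right: "\<And>n t. even n \<Longrightarrow> t \<in> {0..1/20} \<Longrightarrow> v n t =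
        defect (adj (\<alpha> n)) * forced k u (n - 1) t + \<alpha> n * forced k u n t"
begin

abbreviation "y \<equiv> forced k u"

lemma ev_range: "eventually (\<lambda>t. t \<in> {0..1/20::real}) (at_right 0)"
  using eventually_at_right_real[of 0 "1/20"] by (simp add: eventually_mono)

lemma bdd_y: "bdd (y n)"
  unfolding forced_def[abs_def] by (intro bdd_intros bdd_u)

lemmas bdds = bdd_u bdd_v bdd_y

text \<open>From \<open>n + 1\<close> on there is no source, so \<open>y = t u\<close>, and crossing
  a block of \<open>V\<close> gains a factor \<open>t\<close> while a block of \<open>W\<close> does
  not. Accordingly \<open>(X, Y)\<close> alternates between \<open>(u, v)\<close> and
  \<open>(v, y)\<close>.\<close>

lemma schur_right_approx:
  assumes n: "k \<le> n" and j: "2 * N + 2 \<le> j"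
  shows "even n \<Longrightarrow> oeq N (u n) (\<lambda>t. schur_right \<alpha> j (n + 1) t * v n t)"
    and "odd n \<Longrightarrow> oeq N (v n) (\<lambda>t. schur_right \<alpha> j (n + 1) t * y n t)"
proof -
  define X where "X i = (if even (n + int i) then u (n + int i) else v (n + int i))" for i
  define Y where "Y i = (if even (n + int i) then v (n + int i) else y (n + int i))" for i
  \<comment> \<open>Aligns the step count with the lattice: \<open>i + p\<close> is even exactly
    when the next coefficient \<open>\<alpha> (n + 1 + int i)\<close> belongs to a block of
    \<open>V\<close>.\<close>
  define p where "p = (if even n then 1 else 0 :: nat)"
  have bX: "bdd (X i)" and bY: "bdd (Y i)" for i
    by (simp_all add: X_def Y_def bdds)
  have *: "oeq N (X 0) (\<lambda>t. schur j (\<lambda>i. \<alpha> (n + 1 + int i)) t * Y 0 t)"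
  proof (rule schur_approx[where p = p and X = X and Y = Y, OF bX bY _ _ j])
    fix i
    define m where "m = n + int i"
    assume "even (i + p)"
    then have m: "odd m"
      by (auto simp: p_def m_def split: if_splits)
    have "m + 1 \<noteq> k"
      using n by (simp add: m_def)
    then have y: "y (m + 1) t = t *\<^sub>R u (m + 1) t" for t
      by (simp add: forced_def)
    show "eventually (\<lambda>t.
       X i t = - adj (\<alpha> (n + 1 + int i)) * Y i t + defect (\<alpha> (n + 1 + int i)) * (t
           *\<^sub>R X (Suc i) t) \<and>
       Y (Suc i) t = defect (adj (\<alpha> (n + 1 + int i))) * Y i t + \<alpha> (n + 1 + int i) * (t
           *\<^sub>R X (Suc i) t)) (at_right 0)"
      using ev_range
    proof eventually_elim
      case (elim t)
      have idx: "n + int i = m" "n + int (Suc i) = m + 1" "n + 1 + int i = m + 1"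
        by (simp_all add: m_def)
      have XY: "X i = v m" "Y i = y m" "X (Suc i) = u (m + 1)" "Y (Suc i) = v (m + 1)"
        unfolding X_def Y_def idx using m by simp_all
      show ?case
        unfolding XY idx(3) using v_left[of "m + 1" t] v_right[of "m + 1" t] elim m by (simp add: y)
    qed
  next
    fix i
    define m where "m = n + int i"
    assume "odd (i + p)"
    then have m: "even m"
      by (auto simp: p_def m_def split: if_splits)
    have "m + 1 \<noteq> k"
      using n by (simp add: m_def)
    then have y: "y (m + 1) t = t *\<^sub>R u (m + 1) t" for t
      by (simp add: forced_def)
    show "eventually (\<lambda>t.
       X i t = - adj (\<alpha> (n + 1 + int i)) * Y i t + defect (\<alpha> (n + 1 + int i)) * X (Suc i)
           t \<and>
       Y (Suc i) t = t *\<^sub>R (defect (adj (\<alpha> (n + 1 + int i))) * Y i t + \<alpha> (n + 1 +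
           int i) * X (Suc i) t)) (at_right 0)"
      using ev_range
    proof eventually_elim
      case (elim t)
      have idx: "n + int i = m" "n + int (Suc i) = m + 1" "n + 1 + int i = m + 1"
        by (simp_all add: m_def)
      have XY: "X i = u m" "Y i = v m" "X (Suc i) = v (m + 1)" "Y (Suc i) = y (m + 1)"
        unfolding X_def Y_def idx using m by simp_all
      show ?case
        unfolding XY idx(3) using u_left[of "m + 1" t] u_right[of "m + 1" t] elim m by (simp add: y)
    qed
  qed
  show "even n \<Longrightarrow> oeq N (u n) (\<lambda>t. schur_right \<alpha> j (n + 1) t * v n t)"
    and "odd n \<Longrightarrow> oeq N (v n) (\<lambda>t. schur_right \<alpha> j (n + 1) t * y n t)"
    using * by (simp_all add: X_def Y_def schur_right_def)
qed

lemma schur_left_approx: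
  assumes n: "n \<le> k" and j: "2 * N + 2 \<le> j"
  shows "odd n \<Longrightarrow> oeq N (u n) (\<lambda>t. schur_left \<alpha> j n t * v n t)"
    and "even n \<Longrightarrow> oeq N (v n) (\<lambda>t. schur_left \<alpha> j n t * y n t)"
proof -
  define X where "X i = (if odd (n - int i) then u (n - int i) else v (n - int i))" for i
  define Y where "Y i = (if odd (n - int i) then v (n - int i) else y (n - int i))" for i
  \<comment> \<open>The coefficient crossed at step \<open>i\<close> is
    \<open>\<alpha> (n - int i)\<close>, without the shift by 1 of the right half-line, so the phase
    is the opposite one.\<close>
  define p where "p = (if odd n then 1 else 0 :: nat)"
  have bX: "bdd (X i)" and bY: "bdd (Y i)" for i
    by (simp_all add: X_def Y_def bdds)
  have *: "oeq N (X 0) (\<lambda>t. schur j (\<lambda>i. - adj (\<alpha> (n - int i))) t * Y 0 t)"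
  proof (rule schur_approx[where p = p and X = X and Y = Y, OF bX bY _ _ j])
    fix i
    define m where "m = n - int i"
    assume "even (i + p)"
    then have m: "even m"
      by (auto simp: p_def m_def split: if_splits)
    have "m - 1 \<noteq> k"
      using n by (simp add: m_def)
    then have y: "y (m - 1) t = t *\<^sub>R u (m - 1) t" for t
      by (simp add: forced_def)
    show "eventually (\<lambda>t.
       X i t = - adj (- adj (\<alpha> (n - int i))) * Y i t + defect (- adj (\<alpha> (n - int i))) *
           (t *\<^sub>R X (Suc i) t) \<and>
       Y (Suc i) t = defect (adj (- adj (\<alpha> (n - int i)))) * Y i t + - adj (\<alpha> (n - int i))
           * (t *\<^sub>R X (Suc i) t)) (at_right 0)"
      using ev_range
    proof eventually_elim
      case (elim t)
      have idx: "n - int i = m" "n - int (Suc i) = m - 1"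
        by (simp_all add: m_def)
      have XY: "X i = v m" "Y i = y m" "X (Suc i) = u (m - 1)" "Y (Suc i) = v (m - 1)"
        unfolding X_def Y_def idx using m by simp_all
      show ?case
        unfolding XY idx(1) using v_left[of m t] v_right[of m t] elim m by (simp add: y)
    qed
  next
    fix i
    define m where "m = n - int i"
    assume "odd (i + p)"
    then have m: "odd m"
      by (auto simp: p_def m_def split: if_splits)
    have "m - 1 \<noteq> k"
      using n by (simp add: m_def)
    then have y: "y (m - 1) t = t *\<^sub>R u (m - 1) t" for t
      by (simp add: forced_def)
    show "eventually (\<lambda>t.
       X i t = - adj (- adj (\<alpha> (n - int i))) * Y i t + defect (- adj (\<alpha> (n - int i))) * X
           (Suc i) t \<and>
       Y (Suc i) t = t *\<^sub>R (defect (adj (- adj (\<alpha> (n - int i)))) * Y i t + - adj (\<alpha>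
           (n - int i)) * X (Suc i) t)) (at_right 0)"
      using ev_range
    proof eventually_elim
      case (elim t)
      have idx: "n - int i = m" "n - int (Suc i) = m - 1"
        by (simp_all add: m_def)
      have XY: "X i = u m" "Y i = v m" "X (Suc i) = v (m - 1)" "Y (Suc i) = y (m - 1)"
        unfolding X_def Y_def idx using m by simp_all
      show ?case
        unfolding XY idx(1) using u_left[of m t] u_right[of m t] elim m by (simp add: y)
    qed
  qed
  show "odd n \<Longrightarrow> oeq N (u n) (\<lambda>t. schur_left \<alpha> j n t * v n t)"
    and "even n \<Longrightarrow> oeq N (v n) (\<lambda>t. schur_left \<alpha> j n t * y n t)"
    using * by (simp_all add: X_def Y_def schur_left_def)
qed

lemma y_source: "y k t = 1 + t *\<^sub>R u k t"
  by (simp add: forced_def)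

text \<open>The two half-lattices meet at the source: up to the error, \<open>u k = F v k\<close>
  from the right and \<open>v k = G y k\<close> from the left, while
  \<open>y k = 1 + t u k\<close>.\<close>

lemma diagonal_approx_even:
  assumes "even k" "2 * N + 2 \<le> i" "2 * N + 2 \<le> j"
  shows "oeq N (u k) (\<lambda>t. schur_right \<alpha> i (k + 1) t * schur_left \<alpha> j k t * (1 + t
      *\<^sub>R u k t))"
proof -
  have "oeq N (\<lambda>t. schur_right \<alpha> i (k + 1) t * v k t)
      (\<lambda>t. schur_right \<alpha> i (k + 1) t * (schur_left \<alpha> j k t * y k t))"
    using assms by (intro oeq_mult oeq_refl schur_left_approx(2) bdd_intros bdds) auto
  from oeq_trans[OF schur_right_approx(1) this] assms show ?thesis
    by (simp add: y_source mult.assoc)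
qed

lemma diagonal_approx_odd:
  assumes "odd k" "2 * N + 2 \<le> i" "2 * N + 2 \<le> j"
  shows "oeq N (u k) (\<lambda>t. schur_left \<alpha> j k t * schur_right \<alpha> i (k + 1) t * (1 + t
      *\<^sub>R u k t))"
proof -
  have "oeq N (\<lambda>t. schur_left \<alpha> j k t * v k t)
      (\<lambda>t. schur_left \<alpha> j k t * (schur_right \<alpha> i (k + 1) t * y k t))"
    using assms by (intro oeq_mult oeq_refl schur_right_approx(2) bdd_intros bdds) auto
  from oeq_trans[OF schur_left_approx(1) this] assms show ?thesis
    by (simp add: y_source mult.assoc)
qed

text \<open>The name refers to the row \<open>k + 1\<close>, which is even; the source
  \<open>k\<close> is odd, as in \<open>h\<close> at even sites. The left relation
  \<open>u k = G' v k\<close> and the block of \<open>V\<close> at \<open>k + 1\<close> eliminate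
  \<open>u k\<close>, \<open>v k\<close> and \<open>y k\<close>; inserted into
  \<open>u (k + 1) = F v (k + 1)\<close> this leaves \<open>h = F S + t F G h\<close>, where
  \<open>S\<close> is the factor next to \<open>F\<close>.\<close>

lemma off_diagonal_approx_even:
  assumes k: "odd k" and j: "2 * N + 2 \<le> j"
  defines "F \<equiv> schur_right \<alpha> j (k + 2)" and "G' \<equiv> schur_left \<alpha> j k"
    and "G \<equiv> schur_left \<alpha> (Suc j) (k + 1)" and "a \<equiv> \<alpha> (k + 1)" and "h
        \<equiv> u (k + 1)"
  shows "oeq N (\<lambda>t. F t * (defect (adj a) * rinv (1 + t *\<^sub>R G' t * adj a)))
    (\<lambda>t. h t - t *\<^sub>R (F t * G t * h t))"
proof -
  define X where "X t = t *\<^sub>R G' t" for t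
  define T where "T t = rinv (1 + X t * adj a)" for t
  define s r where "s = defect (adj a)" and "r = defect a"
  have F: "bdd F" and G': "bdd G'" and G: "bdd G" and h: "bdd h"
    unfolding F_def G'_def G_def h_def by (intro bdd_intros bdds)+
  have X: "bdd X"
    unfolding X_def by (intro bdd_intros G')
  have un: "unit_near (\<lambda>t. 1 + X t * adj a)"
    using unit_near_one_plus[OF bdd_mult[OF G' bdd_const[of "adj a"]]] by (simp add: X_def)
  have T: "bdd T"
    unfolding T_def by (intro bdd_intros un)
  have ev: "eventually (\<lambda>t. v (k + 1) t = s * y k t + a * (t *\<^sub>R h t) \<and>
      v k t = - adj a * y k t + r * (t *\<^sub>R h t)) (at_right 0)"
    using ev_range
  proof eventually_elim
    case (elim t)
    have "y (k + 1) t = t *\<^sub>R h t"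
      by (simp add: forced_def h_def)
    with v_left[of "k + 1" t] v_right[of "k + 1" t] elim k show ?case
      by (simp add: s_def r_def a_def)
  qed
  have y1: "oeq N (y k) (\<lambda>t. 1 + X t * (- adj a * y k t + r * (t *\<^sub>R h t)))"
  proof -
    have "oeq N (\<lambda>t. 1 + t *\<^sub>R u k t) (\<lambda>t. 1 + t *\<^sub>R (G' t * v k t))"
      unfolding G'_def using k j by (intro oeq_add oeq_refl oeq_scale schur_left_approx) auto
    then show ?thesis
      by (rule oeq_cong) (use ev in \<open>eventually_elim, simp add: y_source X_def\<close>)+
  qed
  have y2: "oeq N (\<lambda>t. (1 + X t * adj a) * y k t) (\<lambda>t. 1 + X t * r * (t *\<^sub>R h t))"
    using oeq_add[OF y1 oeq_refl[of N "\<lambda>t. X t * adj a * y k t"]] by (simp add: algebra_simps)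
  have y3: "oeq N (y k) (\<lambda>t. T t * (1 + X t * r * (t *\<^sub>R h t)))"
  proof (rule oeq_cong)
    show "oeq N (\<lambda>t. T t * ((1 + X t * adj a) * y k t)) (\<lambda>t. T t * (1 + X t * r * (t
        *\<^sub>R h t)))"
      by (intro oeq_mult oeq_refl y2 T bdd_intros X h)
    show "eventually (\<lambda>t. T t * ((1 + X t * adj a) * y k t) = y k t) (at_right 0)"
      using unit_near_eventually[OF un]
      by eventually_elim (simp add: T_def mult.assoc[symmetric])
  qed simp
  have "oeq N h (\<lambda>t. F t * v (k + 1) t)"
    using schur_right_approx(1)[of "k + 1" N j] k j by (simp add: h_def F_def add.commute)
  also have "oeq N (\<lambda>t. F t * v (k + 1) t) (\<lambda>t. F t * (s * y k t + a * (t *\<^sub>R h t)))"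
    by (rule oeq_eventually) (use ev in \<open>eventually_elim, simp\<close>)
  also have "oeq N (\<lambda>t. F t * (s * y k t + a * (t *\<^sub>R h t)))
      (\<lambda>t. F t * (s * (T t * (1 + X t * r * (t *\<^sub>R h t))) + a * (t *\<^sub>R h t)))"
    by (intro oeq_mult oeq_add oeq_refl y3 T F X bdd_intros h)
  also have "oeq N (\<lambda>t. F t * (s * (T t * (1 + X t * r * (t *\<^sub>R h t))) + a * (t *\<^sub>R h t)))
      (\<lambda>t. F t * (s * T t) + t *\<^sub>R (F t * G t * h t))"
  proof (rule oeq_eventually)
    show "eventually (\<lambda>t. F t * (s * (T t * (1 + X t * r * (t *\<^sub>R h t))) + a * (t
        *\<^sub>R h t))
        = F t * (s * T t) + t *\<^sub>R (F t * G t * h t)) (at_right 0)"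
      using unit_near_eventually[OF un] eventually_cay_identities[OF G', of "- adj a"]
    proof eventually_elim
      case (elim t)
      \<comment> \<open>\<open>cay\<close> may also be written with the inverse on the left, as
        \<open>T t * X t\<close>; this is what makes the factor of \<open>t F h\<close> equal to
        \<open>G\<close>.\<close>
      have "cay (- adj a) (X t) = T t * ((1 + X t * adj a) * cay (- adj a) (X t))"
        using elim by (simp add: T_def mult.assoc[symmetric])
      also have "(1 + X t * adj a) * cay (- adj a) (X t) = X t"
        using elim by (simp add: X_def)
      finally have "G t = a + s * (T t * X t) * r"
        unfolding G_def schur_left_Suc mob_def
        by (simp add: G'_def[symmetric] a_def[symmetric] X_def[symmetric] s_def r_def)
      then show ?case
        by (simp add: algebra_simps)
    qed
  qed
  finally have "oeq N h (\<lambda>t. F t * (s * T t) + t *\<^sub>R (F t * G t * h t))" .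
  from oeq_sym[OF oeq_diff[OF this oeq_refl[of N "\<lambda>t. t *\<^sub>R (F t * G t * h t)"]]]
  show ?thesis
    by (simp add: s_def T_def X_def)
qed

text \<open>Here row \<open>k - 1\<close> is coupled to the source by the block of \<open>W\<close>
  at \<open>k\<close>. With \<open>v (k - 1) = t G' h\<close> from the left and
  \<open>v k = F (1 + t u k)\<close> from the right, the equation for \<open>h = u (k - 1)\<close>
  is linear and can be solved.\<close>

lemma off_diagonal_approx_odd:
  assumes k: "odd k" and j: "2 * N + 2 \<le> j"
  defines "F \<equiv> schur_right \<alpha> j (k + 1)" and "G' \<equiv> schur_left \<alpha> j (k - 1)"
      and "a \<equiv> \<alpha> k"
  shows "oeq N (u (k - 1))
    (\<lambda>t. rinv (1 + adj a * (t *\<^sub>R G' t)) * defect a * F t * (1 + t *\<^sub>R u k t))"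
proof -
  define X where "X t = t *\<^sub>R G' t" for t
  define T where "T t = rinv (1 + adj a * X t)" for t
  define h where "h = u (k - 1)"
  define r where "r = defect a"
  have F: "bdd F" and G': "bdd G'" and h: "bdd h"
    unfolding F_def G'_def h_def by (intro bdd_intros bdds)+
  have X: "bdd X"
    unfolding X_def by (intro bdd_intros G')
  have un: "unit_near (\<lambda>t. 1 + adj a * X t)"
    using unit_near_one_plus[OF bdd_mult[OF bdd_const[of "adj a"] G']] by (simp add: X_def)
  have T: "bdd T"
    unfolding T_def by (intro bdd_intros un)
  have "oeq N (v (k - 1)) (\<lambda>t. G' t * y (k - 1) t)"
    using schur_left_approx(2)[of "k - 1" N j] k j by (simp add: G'_def)
  then have v1: "oeq N (v (k - 1)) (\<lambda>t. X t * h t)"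
    by (simp add: forced_def X_def h_def)
  have v2: "oeq N (v k) (\<lambda>t. F t * (1 + t *\<^sub>R u k t))"
    using schur_right_approx(2)[of k N j] k j by (simp add: F_def y_source)
  have "oeq N h (\<lambda>t. - adj a * v (k - 1) t + r * v k t)"
    by (rule oeq_eventually) (use ev_range in \<open>eventually_elim, use u_left k in \<open>simp add:
        h_def a_def r_def\<close>\<close>)
  also have "oeq N (\<lambda>t. - adj a * v (k - 1) t + r * v k t) (\<lambda>t. - adj a * (X t * h t) +
      r * (F t * (1 + t *\<^sub>R u k t)))"
    by (intro oeq_add oeq_mult oeq_refl v1 v2 bdd_intros X h F bdds)
  finally have "oeq N h (\<lambda>t. - adj a * (X t * h t) + r * (F t * (1 + t *\<^sub>R u k t)))" .
  from oeq_add[OF this oeq_refl[of N "\<lambda>t. adj a * X t * h t"]]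
  have "oeq N (\<lambda>t. (1 + adj a * X t) * h t) (\<lambda>t. r * (F t * (1 + t *\<^sub>R u k t)))"
    by (simp add: algebra_simps)
  then have "oeq N (\<lambda>t. T t * ((1 + adj a * X t) * h t)) (\<lambda>t. T t * (r * (F t * (1 + t
      *\<^sub>R u k t))))"
    by (rule oeq_mult[OF oeq_refl]) (intro T bdd_intros F bdds)+
  then have "oeq N h (\<lambda>t. T t * (r * (F t * (1 + t *\<^sub>R u k t))))"
  proof (rule oeq_cong)
    show "eventually (\<lambda>t. T t * ((1 + adj a * X t) * h t) = h t) (at_right 0)"
      using unit_near_eventually[OF un] by eventually_elim (simp add: T_def mult.assoc[symmetric])
  qed simp
  then show ?thesis
    by (simp add: h_def T_def X_def r_def mult.assoc)
qed

text \<open>At \<open>t = 0\<close> only the source enters, so the local equations give the entry in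
  closed form. It coincides with the value at 0 of \<open>F S\<close>, which turns invertibility of
  \<open>h(0)\<close> into permission to cancel \<open>F S\<close>.\<close>

lemma off_diagonal_0_even:
  assumes k: "odd k"
  shows "u (k + 1) 0 = - adj (\<alpha> (k + 2)) * defect (adj (\<alpha> (k + 1)))"
proof -
  have "v (k + 2) 0 = 0"
    using v_left[of "k + 3" 0] k by (simp add: forced_def add.commute)
  moreover have "v (k + 1) 0 = defect (adj (\<alpha> (k + 1)))"
    using v_right[of "k + 1" 0] k by (simp add: forced_def)
  ultimately show ?thesis
    using u_left[of "k + 2" 0] k by (simp add: add.commute)
qed

lemma off_diagonal_0_odd:
  assumes k: "odd k"
  shows "u (k - 1) 0 = - (defect (\<alpha> k) * adj (\<alpha> (k + 1)))"
proof -
  have "v (k - 1) 0 = 0"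
    using v_right[of "k - 1" 0] k by (simp add: forced_def)
  moreover have "v k 0 = - adj (\<alpha> (k + 1))"
    using v_left[of "k + 1" 0] k by (simp add: forced_def)
  ultimately show ?thesis
    using u_left[of k 0] k by simp
qed

end

subsection \<open>Recovering the Verblunsky coefficients\<close>

lemma schur_right_inject:
  assumes "\<And>n. norm (\<alpha>1 n) < 1" "\<And>n. norm (\<alpha>2 n) < 1"
    and "oeq N (schur_right \<alpha>1 j n) (schur_right \<alpha>2 j n)" and "N < j" and "n \<le> m" "m
        \<le> n + int N"
  shows "\<alpha>1 m = \<alpha>2 m"
  using schur_inject[of "\<lambda>i. \<alpha>1 (n + int i)" "\<lambda>i. \<alpha>2 (n + int i)" N j
      "nat (m - n)"] assms
  by (simp add: schur_right_def)

lemma schur_left_inject: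
  assumes "\<And>n. norm (\<alpha>1 n) < 1" "\<And>n. norm (\<alpha>2 n) < 1"
    and "oeq N (schur_left \<alpha>1 j n) (schur_left \<alpha>2 j n)" and "N < j" and "n - int N \<le>
        m" "m \<le> n"
  shows "\<alpha>1 m = \<alpha>2 m"
proof -
  have "- adj (\<alpha>1 m) = - adj (\<alpha>2 m)"
    using schur_inject[of "\<lambda>i. - adj (\<alpha>1 (n - int i))" "\<lambda>i. - adj (\<alpha>2 (n
        - int i))" N j "nat (n - m)"] assms
    by (simp add: schur_left_def)
  then show ?thesis
    by (metis adj_simps(1) neg_equal_iff_equal)
qed

text \<open>Both diagonals satisfy \<open>g = P (1 + t g)\<close> up to the error, and
  \<open>1 + t g\<close> is a unit near 0. The two cut-offs are independent because later one side
  is taken one step longer.\<close>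

lemma diagonal_determines_product_even:
  assumes s1: "green_column \<alpha>1 k u1 v1" and s2: "green_column \<alpha>2 k u2 v2"
    and k: "even k" and eq: "oeq N (u1 k) (u2 k)" and ij: "2 * N + 2 \<le> i" "2 * N + 2 \<le> j"
  shows "oeq N (\<lambda>t. schur_right \<alpha>1 i (k + 1) t * schur_left \<alpha>1 j k t)
    (\<lambda>t. schur_right \<alpha>2 i (k + 1) t * schur_left \<alpha>2 j k t)"
proof (rule oeq_cancel_right)
  interpret S1: green_column \<alpha>1 k u1 v1 by fact
  interpret S2: green_column \<alpha>2 k u2 v2 by fact
  show "oeq N (\<lambda>t. schur_right \<alpha>1 i (k + 1) t * schur_left \<alpha>1 j k t * (1 + t
      *\<^sub>R u1 k t))
     (\<lambda>t. schur_right \<alpha>2 i (k + 1) t * schur_left \<alpha>2 j k t * (1 + t *\<^sub>R u2 k t))"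
    using oeq_trans[OF oeq_sym[OF S1.diagonal_approx_even[OF k ij]] oeq_trans[OF eq
        S2.diagonal_approx_even[OF k ij]]] .
  show "oeq N (\<lambda>t. 1 + t *\<^sub>R u1 k t) (\<lambda>t. 1 + t *\<^sub>R u2 k t)"
    by (intro oeq_add oeq_scale oeq_refl eq)
  show "unit_near (\<lambda>t. 1 + t *\<^sub>R u1 k t)"
    by (rule unit_near_one_plus[OF S1.bdd_u])
qed (intro bdd_intros)

lemma diagonal_determines_product_odd:
  assumes s1: "green_column \<alpha>1 k u1 v1" and s2: "green_column \<alpha>2 k u2 v2"
    and k: "odd k" and eq: "oeq N (u1 k) (u2 k)" and ij: "2 * N + 2 \<le> i" "2 * N + 2 \<le> j"
  shows "oeq N (\<lambda>t. schur_left \<alpha>1 j k t * schur_right \<alpha>1 i (k + 1) t)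
    (\<lambda>t. schur_left \<alpha>2 j k t * schur_right \<alpha>2 i (k + 1) t)"
proof (rule oeq_cancel_right)
  interpret S1: green_column \<alpha>1 k u1 v1 by fact
  interpret S2: green_column \<alpha>2 k u2 v2 by fact
  show "oeq N (\<lambda>t. schur_left \<alpha>1 j k t * schur_right \<alpha>1 i (k + 1) t * (1 + t
      *\<^sub>R u1 k t))
     (\<lambda>t. schur_left \<alpha>2 j k t * schur_right \<alpha>2 i (k + 1) t * (1 + t *\<^sub>R u2 k t))"
    using oeq_trans[OF oeq_sym[OF S1.diagonal_approx_odd[OF k ij]] oeq_trans[OF eq
        S2.diagonal_approx_odd[OF k ij]]] .
  show "oeq N (\<lambda>t. 1 + t *\<^sub>R u1 k t) (\<lambda>t. 1 + t *\<^sub>R u2 k t)"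
    by (intro oeq_add oeq_scale oeq_refl eq)
  show "unit_near (\<lambda>t. 1 + t *\<^sub>R u1 k t)"
    by (rule unit_near_one_plus[OF S1.bdd_u])
qed (intro bdd_intros)

section \<open>Separating the two Schur functions from their products\<close>

lemma defect_identities:
  fixes a :: "'m::finite cmatrix"
  assumes a: "norm a < 1"
  defines "r \<equiv> defect a" and "s \<equiv> defect (adj a)"
  shows "rinv s * a = a * rinv r" "adj a * (rinv s * a) + r = rinv r" "rinv s * a * adj a + s = rinv s"
proof -
  have inv: "r * rinv r = 1" "rinv r * r = 1" "s * rinv s = 1" "rinv s * s = 1"
    using a by (simp_all add: r_def s_def defect_inverse)
  have sq: "r * r = 1 - adj a * a" "s * s = 1 - a * adj a"
    using defect_square[of a] defect_square[of "adj a"] a by (simp_all add: r_def s_def)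
  have ar: "a * r = s * a"
    using defect_intertwines[OF a] by (simp add: r_def s_def)
  have "rinv s * a = rinv s * (a * r) * rinv r"
    using inv by (simp add: mult.assoc)
  also have "\<dots> = (rinv s * s) * a * rinv r"
    by (simp add: ar mult.assoc)
  finally show sa: "rinv s * a = a * rinv r"
    by (simp add: inv)
  have "adj a * (rinv s * a) + r = (adj a * a + r * r) * rinv r"
    by (simp add: sa distrib_right inv mult.assoc)
  then show "adj a * (rinv s * a) + r = rinv r"
    by (simp add: sq)
  have "rinv s * a * adj a + s = rinv s * (a * adj a + s * s)"
    by (simp add: distrib_left mult.assoc[symmetric] inv)
  then show "rinv s * a * adj a + s = rinv s"
    by (simp add: sq)
qed

text \<open>\<open>S\<inverse> G = s\<inverse> a + X r\<inverse>\<close>, where \<open>G = mob (- adj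
    a) X\<close> and \<open>S = s (1 + X adj a)\<inverse>\<close>;
  hence the coefficient \<open>a\<close> and the Schur function \<open>X\<close> can be read off from
      \<open>S\<inverse> G\<close>.\<close>

lemma mob_factor_even:
  fixes a X :: "'m::finite cmatrix"
  assumes a: "norm a < 1"
    and T: "T * (1 + X * adj a) = 1" and c: "(1 + X * adj a) * cay (- adj a) X = X"
  shows "defect (adj a) * T * (rinv (defect (adj a)) * a + X * rinv (defect a)) = mob (- adj a) X"
proof -
  define r s where "r = defect a" and "s = defect (adj a)"
  have s: "s * rinv s = 1"
    using a by (simp add: s_def defect_inverse)
  have cay: "cay (- adj a) X = T * X"
    using arg_cong[OF c, of "(*) T"] by (simp add: mult.assoc[symmetric] T)
  have "rinv s * a + X * rinv r = rinv s * a + X * (adj a * (rinv s * a) + r)"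
    using defect_identities(2)[OF a] by (simp add: r_def s_def)
  also have "\<dots> = (1 + X * adj a) * (rinv s * a) + X * r"
    by (simp add: algebra_simps)
  finally have "s * T * (rinv s * a + X * rinv r) = s * (T * (1 + X * adj a)) * (rinv s * a) + s * (T *
      X) * r"
    by (simp add: algebra_simps)
  also have "\<dots> = (s * rinv s) * a + s * (T * X) * r"
    by (simp add: T mult.assoc)
  finally show ?thesis
    unfolding s by (simp add: mob_def cay r_def s_def)
qed

text \<open>For odd \<open>k\<close> the factors come in the opposite order, \<open>G = Z S\<close>
  with \<open>S = T r\<close> and \<open>Z = s^-1 a + s^-1 X\<close>; the constant term
  \<open>s^-1 a\<close> of \<open>Z\<close> is the same as in the even case.\<close>

lemma mob_factor_odd:
  fixes a X :: "'m::finite cmatrix"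
  assumes a: "norm a < 1"
    and T: "(1 + adj a * X) * T = 1" and c: "cay (- adj a) X = X * T"
  shows "(rinv (defect (adj a)) * a + rinv (defect (adj a)) * X) * (T * defect a) = mob (- adj a) X"
proof -
  define r s where "r = defect a" and "s = defect (adj a)"
  have r: "rinv r * r = 1"
    using a by (simp add: r_def defect_inverse)
  have "rinv s * a + rinv s * X = rinv s * a + (rinv s * a * adj a + s) * X"
    using defect_identities(3)[OF a] by (simp add: s_def)
  also have "\<dots> = rinv s * a * (1 + adj a * X) + s * X"
    by (simp add: algebra_simps)
  finally have "(rinv s * a + rinv s * X) * (T * r) = (rinv s * a) * ((1 + adj a * X) * T) * r + s * (X
      * T) * r"
    by (simp add: algebra_simps)
  also have "\<dots> = a * (rinv r * r) + s * (X * T) * r"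
    using defect_identities(1)[OF a] by (simp add: T mult.assoc r_def s_def)
  finally show ?thesis
    unfolding r by (simp add: mob_def c r_def s_def)
qed

text \<open>\<open>F\<close> to order \<open>N\<close> carries the \<open>N + 1\<close> coefficients
  after \<open>k\<close>, but \<open>t G'\<close> to order \<open>N\<close> gives \<open>G'\<close>
  only to order \<open>N - 1\<close>, hence \<open>N\<close> coefficients before \<open>k\<close>;
  this is the asymmetry of the range in (i).\<close>

lemma coefficients_eq_of_schur:
  assumes contr: "\<And>n. norm (\<alpha>1 n) < 1" "\<And>n. norm (\<alpha>2 n) < 1" and j: "N < j"
    and k: "\<alpha>1 k = \<alpha>2 k"
    and F: "oeq N (schur_right \<alpha>1 j (k + 1)) (schur_right \<alpha>2 j (k + 1))"
    and G: "oeq N (\<lambda>t. t *\<^sub>R schur_left \<alpha>1 j (k - 1) t) (\<lambda>t. t *\<^sub>R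
        schur_left \<alpha>2 j (k - 1) t)"
    and m: "k - int N \<le> m" "m \<le> k + int N + 1"
  shows "\<alpha>1 m = \<alpha>2 m"
proof -
  consider "m = k" | "k + 1 \<le> m" | "m \<le> k - 1"
    by linarith
  then show ?thesis
  proof cases
    case 2
    then show ?thesis
      using m by (intro schur_right_inject[OF contr F j]) auto
  next
    case 3
    \<comment> \<open>\<open>m \<le> k - 1\<close> and \<open>k - int N \<le> m\<close> exclude
      \<open>N = 0\<close>.\<close>
    with m obtain N' where N: "N = Suc N'"
      by (cases N) auto
    have "oeq N' (schur_left \<alpha>1 j (k - 1)) (schur_left \<alpha>2 j (k - 1))"
      using G by (simp add: N oeq_Suc_scale)
    then show ?thesis
      using m 3 j N by (intro schur_left_inject[OF contr, where N = N' and n = "k - 1" and j = j]) auto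
  qed (simp add: k)
qed

lemma unit_near_one_plus_left:
  "bdd X \<Longrightarrow> unit_near (\<lambda>t. 1 + t *\<^sub>R X t * b)" for b :: "'m::finite cmatrix"
  using unit_near_one_plus[of "\<lambda>t. X t * b"] by (simp add: bdd_intros)

lemma unit_near_one_plus_right:
  "bdd X \<Longrightarrow> unit_near (\<lambda>t. 1 + b * (t *\<^sub>R X t))" for b :: "'m::finite cmatrix"
  using unit_near_one_plus[of "\<lambda>t. b * X t"] by (simp add: bdd_intros)

lemma oeq_0_rinv_one_plus_left:
  fixes b :: "'m::finite cmatrix"
  assumes X: "bdd X"
  shows "oeq 0 (\<lambda>t. rinv (1 + t *\<^sub>R X t * b)) (\<lambda>_. 1)"
proof (rule oeq_cancel_left)
  show "oeq 0 (\<lambda>t. (1 + t *\<^sub>R X t * b) * rinv (1 + t *\<^sub>R X t * b)) (\<lambda>_. 1 * 1)"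
    by (rule oeq_eventually) (use unit_near_eventually[OF unit_near_one_plus_left[OF X, of b]] in
        \<open>eventually_elim, simp\<close>)
  show "oeq 0 (\<lambda>t. 1 + t *\<^sub>R X t * b) (\<lambda>_. 1)"
    using oeq_0_scale[of "\<lambda>t. X t * b" 1] by (simp add: bdd_intros X)
qed (intro unit_near_one_plus_left X bdd_intros)+

lemma oeq_0_rinv_one_plus_right:
  fixes b :: "'m::finite cmatrix"
  assumes X: "bdd X"
  shows "oeq 0 (\<lambda>t. rinv (1 + b * (t *\<^sub>R X t))) (\<lambda>_. 1)"
proof (rule oeq_cancel_left)
  show "oeq 0 (\<lambda>t. (1 + b * (t *\<^sub>R X t)) * rinv (1 + b * (t *\<^sub>R X t))) (\<lambda>_.
      1 * 1)"
    by (rule oeq_eventually) (use unit_near_eventually[OF unit_near_one_plus_right[OF X, of b]] in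
        \<open>eventually_elim, simp\<close>)
  show "oeq 0 (\<lambda>t. 1 + b * (t *\<^sub>R X t)) (\<lambda>_. 1)"
    using oeq_0_scale[of "\<lambda>t. b * X t" 1] by (simp add: bdd_intros X)
qed (intro unit_near_one_plus_right X bdd_intros)+

lemma oeq_0_schur_right:
  assumes "0 < j"
  shows "oeq 0 (schur_right \<alpha> j n) (\<lambda>_. - adj (\<alpha> n))"
proof -
  obtain i where "j = Suc i"
    using assms by (cases j) auto
  then have "schur_right \<alpha> j n = (\<lambda>t. mob (\<alpha> n) (t *\<^sub>R schur_right \<alpha>
      i (n + 1) t))"
    by (simp add: fun_eq_iff schur_right_Suc)
  then show ?thesis
    using oeq_0_mob[OF bdd_schur_right, of "\<alpha> n"] by simp
qed

lemma oeq_0_schur_left: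
  assumes "0 < j"
  shows "oeq 0 (schur_left \<alpha> j n) (\<lambda>_. \<alpha> n)"
proof -
  obtain i where "j = Suc i"
    using assms by (cases j) auto
  then have "schur_left \<alpha> j n = (\<lambda>t. mob (- adj (\<alpha> n)) (t *\<^sub>R schur_left
      \<alpha> i (n - 1) t))"
    by (simp add: fun_eq_iff schur_left_Suc)
  then show ?thesis
    using oeq_0_mob[OF bdd_schur_left, of "- adj (\<alpha> n)"] by simp
qed

text \<open>At even \<open>k\<close> the entry \<open>h\<close> lies in column \<open>k - 1\<close>,
  so two columns enter. Once \<open>F S\<close> is cancelled, the constant term of \<open>Z\<close>
  yields the coefficient at \<open>k\<close>, the remainder yields \<open>t G'\<close>, hence
  \<open>S\<close>, and cancelling \<open>S\<close> from \<open>F S\<close> yields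
  \<open>F\<close>.\<close>

lemma coefficients_eq_of_green_even:
  assumes s: "green_column \<alpha>1 k u1 v1" "green_column \<alpha>2 k u2 v2"
    and s': "green_column \<alpha>1 (k - 1) p1 q1" "green_column \<alpha>2 (k - 1) p2 q2"
    and k: "even k" and g: "oeq N (u1 k) (u2 k)" and h: "oeq N (p1 k) (p2 k)"
    and inv: "p1 k 0 * d = 1" "d * p1 k 0 = 1"
    and m: "k - int N \<le> m" "m \<le> k + int N + 1"
  shows "\<alpha>1 m = \<alpha>2 m"
proof -
  interpret H1: green_column \<alpha>1 "k - 1" p1 q1 by fact
  interpret H2: green_column \<alpha>2 "k - 1" p2 q2 by fact
  define j where "j = 2 * N + 2"
  define F where "F \<alpha> = schur_right \<alpha> j (k + 1)" for \<alpha> :: "int \<Rightarrow> 'a cmatrix"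
  define G' where "G' \<alpha> = schur_left \<alpha> j (k - 1)" for \<alpha> :: "int \<Rightarrow> 'a cmatrix"
  \<comment> \<open>One step longer than \<open>G'\<close>, so that \<open>G\<close> is exactly
    \<open>mob (- adj (\<alpha> k))\<close> of \<open>t G'\<close>.\<close>
  define G where "G \<alpha> = schur_left \<alpha> (Suc j) k" for \<alpha> :: "int \<Rightarrow> 'a cmatrix"
  define S where "S \<alpha> t = defect (adj (\<alpha> k)) * rinv (1 + t *\<^sub>R G' \<alpha> t * adj
      (\<alpha> k))" for \<alpha> t
  define Z where "Z \<alpha> t = rinv (defect (adj (\<alpha> k))) * \<alpha> k + t *\<^sub>R G'
      \<alpha> t * rinv (defect (\<alpha> k))" for \<alpha> t
  have bF: "bdd (F \<alpha>)" and bG': "bdd (G' \<alpha>)" and bG: "bdd (G \<alpha>)" for \<alpha>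
    unfolding F_def G'_def G_def by (intro bdd_intros)+
  have bS: "bdd (S \<alpha>)" and bZ: "bdd (Z \<alpha>)" for \<alpha>
    unfolding S_def Z_def by (intro bdd_intros bG' unit_near_one_plus_left)+
  have FG: "oeq N (\<lambda>t. F \<alpha>1 t * G \<alpha>1 t) (\<lambda>t. F \<alpha>2 t * G \<alpha>2 t)"
    unfolding F_def G_def by (rule diagonal_determines_product_even[OF s k g]) (simp_all add: j_def)
  have FS1: "oeq N (\<lambda>t. F \<alpha>1 t * S \<alpha>1 t) (\<lambda>t. p1 k t - t *\<^sub>R (F
      \<alpha>1 t * G \<alpha>1 t * p1 k t))"
    using H1.off_diagonal_approx_even[of N j] k by (simp add: F_def G_def G'_def S_def j_def add.commute)
  have FS2: "oeq N (\<lambda>t. F \<alpha>2 t * S \<alpha>2 t) (\<lambda>t. p2 k t - t *\<^sub>R (F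
      \<alpha>2 t * G \<alpha>2 t * p2 k t))"
    using H2.off_diagonal_approx_even[of N j] k by (simp add: F_def G_def G'_def S_def j_def add.commute)
  have "oeq N (\<lambda>t. p1 k t - t *\<^sub>R (F \<alpha>1 t * G \<alpha>1 t * p1 k t)) (\<lambda>t.
      p2 k t - t *\<^sub>R (F \<alpha>2 t * G \<alpha>2 t * p2 k t))"
    by (intro oeq_diff oeq_scale h oeq_mult[OF FG h] bdd_intros bF bG H2.bdd_u)
  then have FS: "oeq N (\<lambda>t. F \<alpha>1 t * S \<alpha>1 t) (\<lambda>t. F \<alpha>2 t * S
      \<alpha>2 t)"
    using oeq_trans[OF FS1 oeq_trans[OF _ oeq_sym[OF FS2]]] by blast
  have S0: "oeq 0 (S \<alpha>) (\<lambda>_. defect (adj (\<alpha> k)))" for \<alpha>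
    using oeq_mult[OF oeq_refl[of 0 "\<lambda>_. defect (adj (\<alpha> k))"]
        oeq_0_rinv_one_plus_left[OF bG', of \<alpha> "adj (\<alpha> k)"]]
    by (simp add: S_def[abs_def])
  have F0: "oeq 0 (F \<alpha>) (\<lambda>_. - adj (\<alpha> (k + 1)))" for \<alpha>
    unfolding F_def by (rule oeq_0_schur_right) (simp add: j_def)
  have "oeq 0 (\<lambda>t. F \<alpha>1 t * S \<alpha>1 t) (\<lambda>_. p1 k 0)"
    using oeq_mult[OF F0[of \<alpha>1] S0[of \<alpha>1] bF bdd_const] H1.off_diagonal_0_even k by (simp
        add: add.commute)
  then have unFS: "unit_near (\<lambda>t. F \<alpha>1 t * S \<alpha>1 t)"
    by (rule unit_nearI) (fact inv)+
  have SZ: "eventually (\<lambda>t. F \<alpha> t * G \<alpha> t = F \<alpha> t * S \<alpha> t * Z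
      \<alpha> t) (at_right 0)" if "norm (\<alpha> k) < 1" for \<alpha>
    using unit_near_eventually[OF unit_near_one_plus_left[OF bG', of \<alpha> "adj (\<alpha> k)"]]
      eventually_cay_identities[OF bG', of "- adj (\<alpha> k)" \<alpha>]
  proof eventually_elim
    case (elim t)
    have "S \<alpha> t * Z \<alpha> t = G \<alpha> t"
      unfolding S_def Z_def G_def schur_left_Suc G'_def[symmetric]
      using elim by (intro mob_factor_even that) auto
    then show ?case
      by (simp add: mult.assoc)
  qed
  have "oeq N (\<lambda>t. F \<alpha>1 t * S \<alpha>1 t * Z \<alpha>1 t) (\<lambda>t. F \<alpha>2 t *
      S \<alpha>2 t * Z \<alpha>2 t)"
    using FG SZ[OF H1.contr] SZ[OF H2.contr] by (rule oeq_cong)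
  then have ZZ: "oeq N (Z \<alpha>1) (Z \<alpha>2)"
    by (rule oeq_cancel_left[OF _ FS unFS bZ])
  have Z0: "oeq 0 (Z \<alpha>) (\<lambda>_. rinv (defect (adj (\<alpha> k))) * \<alpha> k)" for \<alpha>
    using oeq_0_scale[OF bdd_mult[OF bG'[of \<alpha>] bdd_const], of "rinv (defect (adj (\<alpha> k)))
        * \<alpha> k" "rinv (defect (\<alpha> k))"]
    by (simp add: Z_def[abs_def])
  have "oeq 0 (\<lambda>_. rinv (defect (adj (\<alpha>1 k))) * \<alpha>1 k) (\<lambda>_. rinv (defect
      (adj (\<alpha>2 k))) * \<alpha>2 k)"
    by (rule oeq_trans[OF oeq_sym[OF Z0] oeq_trans[OF oeq_mono[OF ZZ] Z0]]) simp
  then have ak: "\<alpha>1 k = \<alpha>2 k"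
    using rinv_defect_mult_inject[OF H1.contr H2.contr] by (simp add: oeq_const_iff)
  define r where "r = defect (\<alpha>2 k)"
  have "oeq N (\<lambda>t. t *\<^sub>R G' \<alpha>1 t * rinv r) (\<lambda>t. t *\<^sub>R G' \<alpha>2 t
      * rinv r)"
    using oeq_diff[OF ZZ oeq_refl[of N "\<lambda>_. rinv (defect (adj (\<alpha>2 k))) * \<alpha>2 k"]]
        by (simp add: Z_def ak r_def)
  from oeq_mult[OF this oeq_refl[of N "\<lambda>_. r"]]
  have tG: "oeq N (\<lambda>t. t *\<^sub>R G' \<alpha>1 t) (\<lambda>t. t *\<^sub>R G' \<alpha>2 t)"
    using defect_inverse[OF H2.contr, of k] by (simp add: mult.assoc bdd_intros bG' r_def)
  have "oeq N (S \<alpha>1) (S \<alpha>2)"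
    unfolding S_def ak
    by (intro oeq_mult oeq_refl oeq_rinv oeq_add tG unit_near_one_plus_left bdd_intros bG')
  moreover have "unit_near (S \<alpha>1)"
    using H1.contr by (intro unit_nearI[OF S0, of _ "rinv (defect (adj (\<alpha>1 k)))"]) (simp_all
        add: defect_inverse)
  ultimately have FF: "oeq N (F \<alpha>1) (F \<alpha>2)"
    using oeq_cancel_right[OF FS _ _ bF] by blast
  show ?thesis
    using coefficients_eq_of_schur[OF H1.contr H2.contr _ ak FF[unfolded F_def] tG[unfolded G'_def] m]
    by (simp add: j_def)
qed

text \<open>At odd \<open>k\<close> the entries \<open>g\<close> and \<open>h\<close> share column
  \<open>k\<close>, and all products are reversed: \<open>h = S F (1 + t g)\<close> up to the error,
  and \<open>G F = Z (S F)\<close>.\<close>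

lemma coefficients_eq_of_green_odd:
  assumes s: "green_column \<alpha>1 k u1 v1" "green_column \<alpha>2 k u2 v2"
    and k: "odd k" and g: "oeq N (u1 k) (u2 k)" and h: "oeq N (u1 (k - 1)) (u2 (k - 1))"
    and inv: "u1 (k - 1) 0 * d = 1" "d * u1 (k - 1) 0 = 1"
    and m: "k - int N \<le> m" "m \<le> k + int N + 1"
  shows "\<alpha>1 m = \<alpha>2 m"
proof -
  interpret H1: green_column \<alpha>1 k u1 v1 by fact
  interpret H2: green_column \<alpha>2 k u2 v2 by fact
  define j where "j = 2 * N + 2"
  define F where "F \<alpha> = schur_right \<alpha> j (k + 1)" for \<alpha> :: "int \<Rightarrow> 'a cmatrix"
  define G' where "G' \<alpha> = schur_left \<alpha> j (k - 1)" for \<alpha> :: "int \<Rightarrow> 'a cmatrix"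
  define G where "G \<alpha> = schur_left \<alpha> (Suc j) k" for \<alpha> :: "int \<Rightarrow> 'a cmatrix"
  define S where "S \<alpha> t = rinv (1 + adj (\<alpha> k) * (t *\<^sub>R G' \<alpha> t)) * defect
      (\<alpha> k)" for \<alpha> t
  define Z where "Z \<alpha> t = rinv (defect (adj (\<alpha> k))) * \<alpha> k + rinv (defect (adj
      (\<alpha> k))) * (t *\<^sub>R G' \<alpha> t)" for \<alpha> t
  have bF: "bdd (F \<alpha>)" and bG': "bdd (G' \<alpha>)" for \<alpha>
    unfolding F_def G'_def by (intro bdd_intros)+
  have bS: "bdd (S \<alpha>)" and bZ: "bdd (Z \<alpha>)" for \<alpha>
    unfolding S_def Z_def by (intro bdd_intros bG' unit_near_one_plus_right)+
  have GF: "oeq N (\<lambda>t. G \<alpha>1 t * F \<alpha>1 t) (\<lambda>t. G \<alpha>2 t * F \<alpha>2 t)"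
    unfolding F_def G_def by (rule diagonal_determines_product_odd[OF s k g]) (simp_all add: j_def)
  have SF1: "oeq N (u1 (k - 1)) (\<lambda>t. S \<alpha>1 t * F \<alpha>1 t * (1 + t *\<^sub>R u1 k t))"
    using H1.off_diagonal_approx_odd[of N j] k by (simp add: F_def G'_def S_def j_def)
  have SF2: "oeq N (u2 (k - 1)) (\<lambda>t. S \<alpha>2 t * F \<alpha>2 t * (1 + t *\<^sub>R u2 k t))"
    using H2.off_diagonal_approx_odd[of N j] k by (simp add: F_def G'_def S_def j_def)
  have SF: "oeq N (\<lambda>t. S \<alpha>1 t * F \<alpha>1 t) (\<lambda>t. S \<alpha>2 t * F \<alpha>2 t)"
  proof (rule oeq_cancel_right)
    show "oeq N (\<lambda>t. S \<alpha>1 t * F \<alpha>1 t * (1 + t *\<^sub>R u1 k t)) (\<lambda>t. S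
        \<alpha>2 t * F \<alpha>2 t * (1 + t *\<^sub>R u2 k t))"
      by (rule oeq_trans[OF oeq_sym[OF SF1] oeq_trans[OF h SF2]])
    show "oeq N (\<lambda>t. 1 + t *\<^sub>R u1 k t) (\<lambda>t. 1 + t *\<^sub>R u2 k t)"
      by (intro oeq_add oeq_scale oeq_refl g)
    show "unit_near (\<lambda>t. 1 + t *\<^sub>R u1 k t)"
      by (rule unit_near_one_plus[OF H1.bdd_u])
  qed (intro bdd_intros bS bF)
  have S0: "oeq 0 (S \<alpha>) (\<lambda>_. defect (\<alpha> k))" for \<alpha>
    using oeq_mult[OF oeq_0_rinv_one_plus_right[OF bG', of "adj (\<alpha> k)" \<alpha>] oeq_refl[of 0
        "\<lambda>_. defect (\<alpha> k)"]
        unit_near_bdd[OF unit_near_one_plus_right[OF bG']] bdd_const]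
    by (simp add: S_def[abs_def])
  have F0: "oeq 0 (F \<alpha>) (\<lambda>_. - adj (\<alpha> (k + 1)))" for \<alpha>
    unfolding F_def by (rule oeq_0_schur_right) (simp add: j_def)
  have "oeq 0 (\<lambda>t. S \<alpha>1 t * F \<alpha>1 t) (\<lambda>_. u1 (k - 1) 0)"
    using oeq_mult[OF S0[of \<alpha>1] F0[of \<alpha>1] bS bdd_const] H1.off_diagonal_0_odd k by simp
  then have unSF: "unit_near (\<lambda>t. S \<alpha>1 t * F \<alpha>1 t)"
    by (rule unit_nearI) (fact inv)+
  have ZS: "eventually (\<lambda>t. G \<alpha> t * F \<alpha> t = Z \<alpha> t * (S \<alpha> t * F
      \<alpha> t)) (at_right 0)" if "norm (\<alpha> k) < 1" for \<alpha>
    using unit_near_eventually[OF unit_near_one_plus_right[OF bG', of "adj (\<alpha> k)" \<alpha>]]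
  proof eventually_elim
    case (elim t)
    have "Z \<alpha> t * S \<alpha> t = G \<alpha> t"
      unfolding S_def Z_def G_def schur_left_Suc G'_def[symmetric]
      using elim by (intro mob_factor_odd that) (auto simp: cay_def)
    then show ?case
      by (simp add: mult.assoc[symmetric])
  qed
  have "oeq N (\<lambda>t. Z \<alpha>1 t * (S \<alpha>1 t * F \<alpha>1 t)) (\<lambda>t. Z \<alpha>2 t
      * (S \<alpha>2 t * F \<alpha>2 t))"
    using GF ZS[OF H1.contr] ZS[OF H2.contr] by (rule oeq_cong)
  then have ZZ: "oeq N (Z \<alpha>1) (Z \<alpha>2)"
    by (rule oeq_cancel_right[OF _ SF unSF bZ])
  have Z0: "oeq 0 (Z \<alpha>) (\<lambda>_. rinv (defect (adj (\<alpha> k))) * \<alpha> k)" for \<alpha>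
    using oeq_0_scale[OF bdd_mult[OF bdd_const bG'[of \<alpha>]], of "rinv (defect (adj (\<alpha> k)))
        * \<alpha> k" "rinv (defect (adj (\<alpha> k)))"]
    by (simp add: Z_def[abs_def])
  have "oeq 0 (\<lambda>_. rinv (defect (adj (\<alpha>1 k))) * \<alpha>1 k) (\<lambda>_. rinv (defect
      (adj (\<alpha>2 k))) * \<alpha>2 k)"
    by (rule oeq_trans[OF oeq_sym[OF Z0] oeq_trans[OF oeq_mono[OF ZZ] Z0]]) simp
  then have ak: "\<alpha>1 k = \<alpha>2 k"
    using rinv_defect_mult_inject[OF H1.contr H2.contr] by (simp add: oeq_const_iff)
  define s where "s = defect (adj (\<alpha>2 k))"
  have "oeq N (\<lambda>t. rinv s * (t *\<^sub>R G' \<alpha>1 t)) (\<lambda>t. rinv s * (t *\<^sub>R G'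
      \<alpha>2 t))"
    using oeq_diff[OF ZZ oeq_refl[of N "\<lambda>_. rinv (defect (adj (\<alpha>2 k))) * \<alpha>2 k"]]
        by (simp add: Z_def ak s_def)
  from oeq_mult[OF oeq_refl[of N "\<lambda>_. s"] this]
  have tG: "oeq N (\<lambda>t. t *\<^sub>R G' \<alpha>1 t) (\<lambda>t. t *\<^sub>R G' \<alpha>2 t)"
    using defect_inverse[of "adj (\<alpha>2 k)"] H2.contr by (simp add: mult.assoc[symmetric]
        bdd_intros bG' s_def)
  have "oeq N (S \<alpha>1) (S \<alpha>2)"
    unfolding S_def ak
    by (intro oeq_mult oeq_refl oeq_rinv oeq_add tG unit_near_one_plus_right bdd_intros bG')
  moreover have "unit_near (S \<alpha>1)"
    using H1.contr by (intro unit_nearI[OF S0, of _ "rinv (defect (\<alpha>1 k))"]) (simp_all add: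
        defect_inverse)
  ultimately have FF: "oeq N (F \<alpha>1) (F \<alpha>2)"
    using oeq_cancel_left[OF SF _ _ bF] by blast
  show ?thesis
    using coefficients_eq_of_schur[OF H1.contr H2.contr _ ak FF[unfolded F_def] tG[unfolded G'_def] m]
    by (simp add: j_def)
qed

text \<open>Knowing the coefficient at \<open>k\<close>, each of the functions \<open>F\<close>,
    \<open>G'\<close> on the two sides of \<open>k\<close>
  determines a product with the other one to one order more, which bootstraps.\<close>

lemma coefficients_eq_of_diagonals:
  assumes s: "green_column \<alpha>1 k u1 v1" "green_column \<alpha>2 k u2 v2"
    and s': "green_column \<alpha>1 (k - 1) p1 q1" "green_column \<alpha>2 (k - 1) p2 q2"
    and g: "oeq N (u1 k) (u2 k)" and g': "oeq N (p1 (k - 1)) (p2 (k - 1))"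
    and ak: "\<alpha>1 k = \<alpha>2 k" and inv: "\<alpha>1 k * d = 1" "d * \<alpha>1 k = 1"
    and m: "k - int N - 1 \<le> m" "m \<le> k + int N + 1"
  shows "\<alpha>1 m = \<alpha>2 m"
proof -
  interpret S1: green_column \<alpha>1 k u1 v1 by fact
  interpret S2: green_column \<alpha>2 k u2 v2 by fact
  define j where "j = 2 * N + 2"
  define F where "F \<alpha> = schur_right \<alpha> j (k + 1)" for \<alpha> :: "int \<Rightarrow> 'a cmatrix"
  define Fk where "Fk \<alpha> = schur_right \<alpha> (Suc j) k" for \<alpha> :: "int \<Rightarrow> 'a
      cmatrix"
  define G where "G \<alpha> = schur_left \<alpha> j (k - 1)" for \<alpha> :: "int \<Rightarrow> 'a cmatrix"
  define Gk where "Gk \<alpha> = schur_left \<alpha> (Suc j) k" for \<alpha> :: "int \<Rightarrow> 'a cmatrix"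
  have bF: "bdd (F \<alpha>)" and bG: "bdd (G \<alpha>)" for \<alpha>
    unfolding F_def G_def by (intro bdd_intros)+
  have uG: "unit_near (Gk \<alpha>1)"
    unfolding Gk_def by (rule unit_nearI[OF _ inv]) (rule oeq_0_schur_left, simp)
  have uF: "unit_near (Fk \<alpha>1)"
    unfolding Fk_def
  proof (rule unit_nearI[OF oeq_0_schur_right])
    show "- adj (\<alpha>1 k) * - adj d = 1" "- adj d * - adj (\<alpha>1 k) = 1"
      using inv[THEN arg_cong[of _ _ adj]] by simp_all
  qed simp
  \<comment> \<open>Column \<open>k\<close> gives the product of \<open>F\<close> with
    \<open>Gk\<close>, whose constant term is the invertible coefficient at \<open>k\<close>; so
    \<open>Gk\<close> can be cancelled.\<close>
  have stepF: "oeq n (F \<alpha>1) (F \<alpha>2)" if "oeq n (Gk \<alpha>1) (Gk \<alpha>2)" "n \<le> N" for n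
  proof (cases "even k")
    case True
    from diagonal_determines_product_even[OF s True g, of j "Suc j"]
    have "oeq n (\<lambda>t. F \<alpha>1 t * Gk \<alpha>1 t) (\<lambda>t. F \<alpha>2 t * Gk \<alpha>2 t)"
      using that(2) by (auto simp: j_def F_def Gk_def intro: oeq_mono)
    then show ?thesis
      using that(1) uG bF by (rule oeq_cancel_right)
  next
    case False
    from diagonal_determines_product_odd[OF s False g, of j "Suc j"]
    have "oeq n (\<lambda>t. Gk \<alpha>1 t * F \<alpha>1 t) (\<lambda>t. Gk \<alpha>2 t * F \<alpha>2 t)"
      using that(2) by (auto simp: j_def F_def Gk_def intro: oeq_mono)
    then show ?thesis
      using that(1) uG bF by (rule oeq_cancel_left)
  qed
  \<comment> \<open>In column \<open>k - 1\<close> the right Schur function starts at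
    \<open>k\<close>: this column gives the product of \<open>G\<close> with \<open>Fk\<close>,
    whose constant term is \<open>- adj (\<alpha>1 k)\<close>.\<close>
  have stepG: "oeq n (G \<alpha>1) (G \<alpha>2)" if "oeq n (Fk \<alpha>1) (Fk \<alpha>2)" "n \<le> N" for n
  proof (cases "even k")
    case True
    then have "odd (k - 1)"
      by simp
    from diagonal_determines_product_odd[OF s' this g', of "Suc j" j]
    have "oeq n (\<lambda>t. G \<alpha>1 t * Fk \<alpha>1 t) (\<lambda>t. G \<alpha>2 t * Fk \<alpha>2 t)"
      using that(2) by (auto simp: j_def G_def Fk_def intro: oeq_mono)
    then show ?thesis
      using that(1) uF bG by (rule oeq_cancel_right)
  next
    case False
    then have "even (k - 1)"
      by simp
    from diagonal_determines_product_even[OF s' this g', of "Suc j" j]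
    have "oeq n (\<lambda>t. Fk \<alpha>1 t * G \<alpha>1 t) (\<lambda>t. Fk \<alpha>2 t * G \<alpha>2 t)"
      using that(2) by (auto simp: j_def G_def Fk_def intro: oeq_mono)
    then show ?thesis
      using that(1) uF bG by (rule oeq_cancel_left)
  qed
  have step: "oeq n (F \<alpha>1) (F \<alpha>2) \<and> oeq n (G \<alpha>1) (G \<alpha>2)"
    if t: "oeq n (\<lambda>t. t *\<^sub>R F \<alpha>1 t) (\<lambda>t. t *\<^sub>R F \<alpha>2 t)" "oeq
        n (\<lambda>t. t *\<^sub>R G \<alpha>1 t) (\<lambda>t. t *\<^sub>R G \<alpha>2 t)"
      and n: "n \<le> N" for n
  proof -
    have Fk: "Fk \<alpha> = (\<lambda>t. mob (\<alpha> k) (t *\<^sub>R F \<alpha> t))" and Gk: "Gk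
        \<alpha> = (\<lambda>t. mob (- adj (\<alpha> k)) (t *\<^sub>R G \<alpha> t))" for \<alpha>
      by (simp_all add: fun_eq_iff Fk_def Gk_def F_def G_def schur_right_Suc schur_left_Suc)
    have "oeq n (Fk \<alpha>1) (Fk \<alpha>2)" "oeq n (Gk \<alpha>1) (Gk \<alpha>2)"
      unfolding Fk Gk ak by (intro oeq_mob bF bG t)+
    with stepF stepG n show ?thesis
      by blast
  qed
  have FG: "oeq n (F \<alpha>1) (F \<alpha>2) \<and> oeq n (G \<alpha>1) (G \<alpha>2)" if "n \<le> N" for n
    using that
  proof (induction n)
    case 0
    \<comment> \<open>At order 0 the functions \<open>t F\<close> and \<open>t G\<close> simply tend
      to 0, so the induction starts for free; each later round passes from order \<open>n\<close> of
      \<open>F\<close>, \<open>G\<close> to order \<open>n + 1\<close> of \<open>t F\<close>,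
      \<open>t G\<close>, hence of \<open>Fk\<close>, \<open>Gk\<close>.\<close>
    have *: "oeq 0 (\<lambda>t. t *\<^sub>R f t) (\<lambda>t. t *\<^sub>R g t)" if "bdd f" "bdd g" for
        f g :: "real \<Rightarrow> 'a cmatrix"
      using small_0_scale[OF bdd_diff[OF that]] by (simp add: oeq_def scaleR_diff_right)
    show ?case
      by (intro step * bF bG) simp
  next
    case (Suc n)
    then show ?case
      by (intro step) (auto simp: oeq_Suc_scale)
  qed
  have N: "N < j"
    by (simp add: j_def)
  \<comment> \<open>Both \<open>F\<close> and \<open>G\<close> are now known to order
    \<open>N\<close>, so \<open>N + 1\<close> coefficients are found on each side of
    \<open>k\<close>.\<close>
  consider "m = k" | "k + 1 \<le> m" | "m \<le> k - 1"
    by linarith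
  then show ?thesis
  proof cases
    case 2
    show ?thesis
      by (rule schur_right_inject[OF S1.contr S2.contr _ N, where n = "k + 1"]) (use FG[of N] m 2 in
          \<open>simp_all add: F_def\<close>)
  next
    case 3
    show ?thesis
      by (rule schur_left_inject[OF S1.contr S2.contr _ N, where n = "k - 1"]) (use FG[of N] m 3 in
          \<open>simp_all add: G_def\<close>)
  qed (simp add: ak)
qed

subsection \<open>The resolvent of the CMV operator near \<open>0\<close>\<close>

lemma rho_tilde_eq: "rho_tilde a = rho (adj_mat a)"
  by (simp add: rho_tilde_def rho_def adj_mat_simps)

lemma of_mat_defect: "of_mat (rho a) = defect (of_mat a)" "of_mat (rho_tilde a) = defect (adj (of_mat a))"
    "of_mat (adj_mat a) = adj (of_mat a)"
  by (simp_all add: rho_tilde_eq defect.abs_eq adj.abs_eq)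

lemma norm_of_mat: "norm (of_mat A) = op_norm A"
  by (simp add: norm_cmatrix.abs_eq)

lemma Theta_simps:
  "Theta a $ 1 $ 1 = - a" "Theta a $ 1 $ 2 = rho_tilde a" "Theta a $ 2 $ 1 = rho a" "Theta a $ 2 $ 2 =
      adj_mat a"
  by (simp_all add: Theta_def)

lemma rho_identities:
  fixes a :: "complex^'m^'m"
  assumes a: "op_norm a < 1"
  shows "rho a ** rho a + adj_mat a ** a = mat 1" "rho_tilde a ** rho_tilde a + a ** adj_mat a = mat 1"
    "a ** rho a = rho_tilde a ** a" "rho a ** adj_mat a = adj_mat a ** rho_tilde a"
proof -
  have c: "norm (of_mat a) < 1" "norm (adj (of_mat a)) < 1"
    using a by (simp_all add: norm_of_mat)
  have eqI: "of_mat A = of_mat B \<Longrightarrow> A = B" for A B :: "complex^'m^'m"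
    by (simp add: of_mat_inject)
  have om: "of_mat (A + B) = of_mat A + of_mat B" "of_mat (A ** B) = of_mat A * of_mat B" "of_mat (mat 1) = 1"
    for A B :: "complex^'m^'m"
    by (simp_all add: plus_cmatrix.abs_eq times_cmatrix.abs_eq one_cmatrix.abs_eq)
  show "rho a ** rho a + adj_mat a ** a = mat 1" "rho_tilde a ** rho_tilde a + a ** adj_mat a = mat 1"
    "a ** rho a = rho_tilde a ** a" "rho a ** adj_mat a = adj_mat a ** rho_tilde a"
    using defect_square[OF c(1)] defect_square[OF c(2)] defect_intertwines[OF c(1)]
        defect_intertwines[OF c(2)]
    by (auto intro!: eqI simp: om of_mat_defect)
qed

lemma op_norm_bounds:
  fixes a :: "complex^'m^'m"
  assumes a: "op_norm a < 1"
  shows "op_norm (rho a) \<le> 2" "op_norm (rho_tilde a) \<le> 2" "op_norm (adj_mat a) \<le> 1"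
  using norm_defect_le[of "of_mat a"] norm_defect_le[of "adj (of_mat a)"] a norm_adj[of "of_mat a"]
  by (simp_all add: norm_of_mat rho_tilde_eq of_mat_defect(1,3)[symmetric])

lemma norm_matrix_vector_le':
  assumes "op_norm A \<le> c"
  shows "norm (A *v x) \<le> c * norm x"
  by (rule order_trans[OF norm_matrix_vector_le]) (simp add: assms mult_right_mono)

text \<open>\<open>V\<close> and \<open>W\<close> are the cases \<open>p = True\<close> and \<open>p =
    False\<close> of one operator.\<close>

definition pair_op :: "bool \<Rightarrow> (int \<Rightarrow> complex^'m^'m) \<Rightarrow> (int
    \<Rightarrow> complex^'m) \<Rightarrow> int \<Rightarrow> complex^'m" where
  "pair_op p \<alpha> f n = (if even n = p then rho (\<alpha> n) *v f (n - 1) + adj_mat (\<alpha> n) *v f n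
     else - \<alpha> (n + 1) *v f n + rho_tilde (\<alpha> (n + 1)) *v f (n + 1))"

text \<open>The adjoint blocks. They invert \<open>pair_op\<close> on all sequences, not just on
  \<open>ell2\<close>, by the identities between a contraction and its defects.\<close>

definition pair_adj :: "bool \<Rightarrow> (int \<Rightarrow> complex^'m^'m) \<Rightarrow> (int
    \<Rightarrow> complex^'m) \<Rightarrow> int \<Rightarrow> complex^'m" where
  "pair_adj p \<alpha> f n = (if even n = p then rho_tilde (\<alpha> n) *v f (n - 1) + \<alpha> n *v f n
     else - adj_mat (\<alpha> (n + 1)) *v f n + rho (\<alpha> (n + 1)) *v f (n + 1))"

lemma cmv_V_eq: "cmv_V = pair_op True"
  by (auto simp: fun_eq_iff cmv_V_def pair_op_def Theta_simps)

lemma cmv_W_eq: "cmv_W = pair_op False"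
  by (auto simp: fun_eq_iff cmv_W_def pair_op_def Theta_simps)

lemma scaleR_eq_vector_smult: "t *\<^sub>R x = complex_of_real t *s x" for x :: "complex^'m"
  unfolding vec_eq_iff vector_scaleR_component vector_smult_component by (simp add: scaleR_conv_of_real)

lemma uminus_matrix_vector: "(- A) *v x = - (A *v x)" for A :: "complex^'m^'m"
  using matrix_vector_mult_diff_rdistrib[of 0 A x] by simp

definition partner :: "bool \<Rightarrow> int \<Rightarrow> int" where
  "partner p n = (if even n = p then n - 1 else n + 1)"

context
  fixes \<alpha> :: "int \<Rightarrow> complex^'m^'m"
  assumes contr: "\<And>n. op_norm (\<alpha> n) < 1"
begin

lemma pair_op_pair_adj: "pair_op p \<alpha> (pair_adj p \<alpha> f) = f"
proof
  fix n
  note id = rho_identities[OF contr]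
  show "pair_op p \<alpha> (pair_adj p \<alpha> f) n = f n"
  proof (cases "even n = p")
    case True
    then have "(even (n - 1) = p) = False"
      by auto
    with True have "pair_op p \<alpha> (pair_adj p \<alpha> f) n
      = (adj_mat (\<alpha> n) ** rho_tilde (\<alpha> n) - rho (\<alpha> n) ** adj_mat (\<alpha> n)) *v
          f (n - 1)
        + (rho (\<alpha> n) ** rho (\<alpha> n) + adj_mat (\<alpha> n) ** \<alpha> n) *v f n"
      by (simp add: pair_op_def pair_adj_def matrix_vector_right_distrib matrix_vector_mult_add_rdistrib
          matrix_vector_mult_diff_rdistrib matrix_vector_mul_assoc[symmetric] uminus_matrix_vector
          vec.neg algebra_simps)
    then show ?thesis
      by (simp add: id)
  next
    case False
    then have "even (n + 1) = p"
      by auto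
    with False have "pair_op p \<alpha> (pair_adj p \<alpha> f) n
      = (\<alpha> (n + 1) ** adj_mat (\<alpha> (n + 1)) + rho_tilde (\<alpha> (n + 1)) ** rho_tilde
          (\<alpha> (n + 1))) *v f n
        + (rho_tilde (\<alpha> (n + 1)) ** \<alpha> (n + 1) - \<alpha> (n + 1) ** rho (\<alpha> (n +
            1))) *v f (n + 1)"
      by (simp add: pair_op_def pair_adj_def matrix_vector_right_distrib matrix_vector_mult_add_rdistrib
          matrix_vector_mult_diff_rdistrib matrix_vector_mul_assoc[symmetric] uminus_matrix_vector
          vec.neg algebra_simps)
    then show ?thesis
      using id(2)[of "n + 1"] by (simp add: id(3) add.commute)
  qed
qed

lemma pair_adj_pair_op: "pair_adj p \<alpha> (pair_op p \<alpha> f) = f"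
proof
  fix n
  note id = rho_identities[OF contr]
  show "pair_adj p \<alpha> (pair_op p \<alpha> f) n = f n"
  proof (cases "even n = p")
    case True
    then have "(even (n - 1) = p) = False"
      by auto
    with True have "pair_adj p \<alpha> (pair_op p \<alpha> f) n
      = (\<alpha> n ** rho (\<alpha> n) - rho_tilde (\<alpha> n) ** \<alpha> n) *v f (n - 1)
        + (rho_tilde (\<alpha> n) ** rho_tilde (\<alpha> n) + \<alpha> n ** adj_mat (\<alpha> n)) *v f n"
      by (simp add: pair_op_def pair_adj_def matrix_vector_right_distrib matrix_vector_mult_add_rdistrib
          matrix_vector_mult_diff_rdistrib matrix_vector_mul_assoc[symmetric] uminus_matrix_vector
          vec.neg algebra_simps)
    then show ?thesis
      by (simp add: id)
  next
    case False
    then have "even (n + 1) = p"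
      by auto
    with False have "pair_adj p \<alpha> (pair_op p \<alpha> f) n
      = (adj_mat (\<alpha> (n + 1)) ** \<alpha> (n + 1) + rho (\<alpha> (n + 1)) ** rho (\<alpha> (n +
          1))) *v f n
        + (rho (\<alpha> (n + 1)) ** adj_mat (\<alpha> (n + 1)) - adj_mat (\<alpha> (n + 1)) **
            rho_tilde (\<alpha> (n + 1))) *v f (n + 1)"
      by (simp add: pair_op_def pair_adj_def matrix_vector_right_distrib matrix_vector_mult_add_rdistrib
          matrix_vector_mult_diff_rdistrib matrix_vector_mul_assoc[symmetric] uminus_matrix_vector
          vec.neg algebra_simps)
    then show ?thesis
      using id(1)[of "n + 1"] by (simp add: id(4) add.commute)
  qed
qed

text \<open>Coefficients have norm at most 1 and defects at most 2. Each of the inverses of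
  \<open>V\<close> and \<open>W\<close> is thus bounded by 3, that of \<open>U\<close> by 9, both
  for suprema and for sums of norms.\<close>

lemma norm_pair_adj_le: "norm (pair_adj p \<alpha> f n) \<le> norm (f n) + 2 * norm (f (partner p n))"
proof (cases "even n = p")
  case True
  have "norm (rho_tilde (\<alpha> n) *v f (n - 1)) \<le> 2 * norm (f (n - 1))" "norm (\<alpha> n *v f
      n) \<le> 1 * norm (f n)"
    using op_norm_bounds[OF contr] contr[of n, THEN less_imp_le] by (intro norm_matrix_vector_le'; simp)+
  then show ?thesis
    using True by (simp add: pair_adj_def partner_def) (smt (verit) norm_triangle_ineq)
next
  case False
  have "norm (adj_mat (\<alpha> (n + 1)) *v f n) \<le> 1 * norm (f n)" "norm (rho (\<alpha> (n + 1)) *v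
      f (n + 1)) \<le> 2 * norm (f (n + 1))"
    using op_norm_bounds[OF contr] by (intro norm_matrix_vector_le'; simp)+
  then show ?thesis
    using False norm_triangle_ineq[of "- (adj_mat (\<alpha> (n + 1)) *v f n)" "rho (\<alpha> (n + 1))
        *v f (n + 1)"]
    by (simp add: pair_adj_def partner_def uminus_matrix_vector)
qed

lemma pair_adj_bounded:
  assumes "\<And>n. norm (f n) \<le> C"
  shows "norm (pair_adj p \<alpha> f n) \<le> 3 * C"
  using norm_pair_adj_le[of p f n] assms[of n] assms[of "partner p n"] by linarith

lemma pair_adj_sum_bounded:
  assumes f: "\<And>A. finite A \<Longrightarrow> (\<Sum>n\<in>A. norm (f n)) \<le> C" and A: "finite A"
  shows "(\<Sum>n\<in>A. norm (pair_adj p \<alpha> f n)) \<le> 3 * C"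
proof -
  \<comment> \<open>\<open>partner\<close> exchanges the two coordinates of a block, so the shifted
    sum again runs over distinct sites.\<close>
  have inj: "inj_on (partner p) A"
    by (auto simp: inj_on_def partner_def split: if_splits)
  have "(\<Sum>n\<in>A. norm (pair_adj p \<alpha> f n)) \<le> (\<Sum>n\<in>A. norm (f n) + 2 * norm (f
      (partner p n)))"
    by (intro sum_mono norm_pair_adj_le)
  also have "\<dots> = (\<Sum>n\<in>A. norm (f n)) + 2 * (\<Sum>n\<in>partner p ` A. norm (f n))"
    by (simp add: sum.distrib sum_distrib_left sum.reindex[OF inj])
  finally show ?thesis
    using f[OF A] f[of "partner p ` A"] A by simp
qed

lemma pair_adj_add_scaleR:
  "pair_adj p \<alpha> (\<lambda>n. f n + t *\<^sub>R g n) = (\<lambda>n. pair_adj p \<alpha> f n + t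
      *\<^sub>R pair_adj p \<alpha> g n)"
  by (simp add: fun_eq_iff pair_adj_def matrix_vector_right_distrib algebra_simps
      linear_scale[OF bounded_linear.linear[OF bounded_linear_matrix_vector]])

lemma pair_adj_sums:
  assumes "\<And>n. (\<lambda>j. f j n) sums g n"
  shows "(\<lambda>j. pair_adj p \<alpha> (f j) n) sums pair_adj p \<alpha> g n"
proof -
  note s = bounded_linear.sums[OF bounded_linear_matrix_vector assms]
  show ?thesis
    unfolding pair_adj_def by (cases "even n = p") (simp_all add: sums_add[OF s s])
qed

definition cmv_inv :: "(int \<Rightarrow> complex^'m) \<Rightarrow> int \<Rightarrow> complex^'m" where
  "cmv_inv f = pair_adj False \<alpha> (pair_adj True \<alpha> f)"

lemma cmv_U_cmv_inv: "cmv_U \<alpha> (cmv_inv f) = f"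
  by (simp add: cmv_U_def cmv_inv_def cmv_V_eq cmv_W_eq pair_op_pair_adj)

text \<open>Neumann series: the sum over \<open>j\<close> of \<open>t^j\<close> times the inverse of
  \<open>U\<close> applied \<open>j + 1\<close> times to \<open>\<delta>\<close>. It is estimated by
  sums of norms, with ratio \<open>9 t\<close> at most \<open>9/20\<close>; summable norms are
  square summable, so the sum lies in \<open>ell2\<close>.\<close>

lemma ex_resolvent:
  fixes \<delta> :: "int \<Rightarrow> complex^'m"
  assumes \<delta>: "\<And>A. finite A \<Longrightarrow> (\<Sum>n\<in>A. norm (\<delta> n)) \<le> 1"
      and t: "t \<in> {0..1/20}"
  shows "\<exists>f\<in>ell2. (\<lambda>n. cmv_U \<alpha> f n - complex_of_real t *s f n) = \<delta>"
proof -
  define x where "x j = (cmv_inv ^^ Suc j) \<delta>" for j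
  have xS: "x (Suc j) = cmv_inv (x j)" for j
    by (simp add: x_def)
  have x0: "x 0 = cmv_inv \<delta>"
    by (simp add: x_def)
  have x1: "(\<Sum>n\<in>A. norm (x j n)) \<le> 9 * 9 ^ j" if "finite A" for A j
    using that
  proof (induction j arbitrary: A)
    case 0
    show ?case
      unfolding x0 cmv_inv_def
      by (rule order_trans[OF pair_adj_sum_bounded[OF pair_adj_sum_bounded[OF \<delta>]]]) (use 0 in auto)
  next
    case (Suc j)
    show ?case
      unfolding xS cmv_inv_def
      by (rule order_trans[OF pair_adj_sum_bounded[OF pair_adj_sum_bounded[OF Suc.IH]]]) (use Suc.prems
          in auto)
  qed
  have tj: "t ^ j * (9 * 9 ^ j) \<le> 9 * (9 / 20) ^ j" for j
  proof -
    have "t ^ j \<le> (1 / 20) ^ j"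
      using t by (intro power_mono) auto
    then have "t ^ j * 9 ^ j \<le> (1 / 20) ^ j * 9 ^ j"
      by (intro mult_right_mono) auto
    then show ?thesis
      by (simp add: power_divide)
  qed
  have xj: "t ^ j * (\<Sum>n\<in>A. norm (x j n)) \<le> 9 * (9 / 20) ^ j" if "finite A" for A j
    using t by (intro order_trans[OF mult_left_mono[OF x1[OF that]] tj]) auto
  have geo: "summable (\<lambda>j. 9 * (9 / 20 :: real) ^ j)"
    by (intro summable_mult summable_geometric) simp
  have sn: "summable (\<lambda>j. norm (t ^ j *\<^sub>R x j n))" for n
    using xj[of "{n}"] t by (intro summable_comparison_test'[OF geo, of 0]) simp
  define f where "f n = (\<Sum>j. t ^ j *\<^sub>R x j n)" for n
  have f: "(\<lambda>j. t ^ j *\<^sub>R x j n) sums f n" for n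
    unfolding f_def by (rule summable_sums[OF summable_norm_cancel[OF sn]])
  have f1: "(\<Sum>n\<in>A. norm (f n)) \<le> 20" if A: "finite A" for A
  proof -
    have "(\<Sum>n\<in>A. norm (f n)) \<le> (\<Sum>n\<in>A. \<Sum>j. norm (t ^ j *\<^sub>R x j n))"
      unfolding f_def by (intro sum_mono summable_norm sn)
    also have "\<dots> = (\<Sum>j. \<Sum>n\<in>A. norm (t ^ j *\<^sub>R x j n))"
      by (rule suminf_sum[symmetric]) (rule sn)
    also have "\<dots> \<le> (\<Sum>j. 9 * (9 / 20) ^ j)"
      using xj[OF A] t by (intro suminf_le geo summable_sum sn) (simp add: sum_distrib_left)
    \<comment> \<open>The geometric series has the value \<open>180/11\<close>.\<close>
    also have "\<dots> \<le> 20"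
      by (simp add: suminf_mult suminf_geometric)
    finally show ?thesis .
  qed
  have "f \<in> ell2"
    unfolding ell2_def mem_Collect_eq
  proof (rule nonneg_bdd_above_summable_on)
    show "bdd_above (sum (\<lambda>n. (norm (f n))\<^sup>2) ` {F. F \<subseteq> UNIV \<and> finite F})"
    proof (rule bdd_aboveI2)
      fix F :: "int set"
      assume F: "F \<in> {F. F \<subseteq> UNIV \<and> finite F}"
      have "norm (f n) \<le> 20" for n
        using f1[of "{n}"] by simp
      then have "(\<Sum>n\<in>F. (norm (f n))\<^sup>2) \<le> (\<Sum>n\<in>F. 20 * norm (f n))"
        unfolding power2_eq_square by (intro sum_mono mult_right_mono) auto
      also have "\<dots> \<le> 20 * 20"
        using f1[of F] F by (simp add: sum_distrib_left[symmetric])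
      finally show "(\<Sum>n\<in>F. (norm (f n))\<^sup>2) \<le> 20 * 20" .
    qed
  qed simp
  moreover have "f = cmv_inv (\<lambda>n. \<delta> n + t *\<^sub>R f n)"
  proof
    fix n
    have inv_f: "(\<lambda>j. t ^ j *\<^sub>R x (Suc j) n) sums cmv_inv f n" for n
    proof -
      have 1: "pair_adj p \<alpha> (\<lambda>n. c *\<^sub>R g n) = (\<lambda>n. c *\<^sub>R pair_adj p
          \<alpha> g n)" for p c g
        using pair_adj_add_scaleR[of p "\<lambda>_. 0" c g] by (auto simp: fun_eq_iff pair_adj_def)
      have "(\<lambda>j. pair_adj False \<alpha> (pair_adj True \<alpha> (\<lambda>n. t ^ j *\<^sub>R x
          j n)) n) sums cmv_inv f n"
        unfolding cmv_inv_def by (intro pair_adj_sums f)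
      then show ?thesis
        by (simp add: 1 xS cmv_inv_def)
    qed
    have "(\<lambda>j. t ^ Suc j *\<^sub>R x (Suc j) n) sums (t *\<^sub>R cmv_inv f n)"
      using sums_scaleR_right[OF inv_f, of t n] by simp
    then have "(\<lambda>j. t ^ j *\<^sub>R x j n) sums (t *\<^sub>R cmv_inv f n + x 0 n)"
      by (subst (asm) sums_Suc_iff) simp
    then have "f n = x 0 n + t *\<^sub>R cmv_inv f n"
      using sums_unique2[OF f] by (simp add: add.commute)
    also have "\<dots> = cmv_inv (\<lambda>n. \<delta> n + t *\<^sub>R f n) n"
      by (simp add: x0 cmv_inv_def pair_adj_add_scaleR)
    finally show "f n = cmv_inv (\<lambda>n. \<delta> n + t *\<^sub>R f n) n" .
  qed
  then have "cmv_U \<alpha> f = (\<lambda>n. \<delta> n + t *\<^sub>R f n)"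
    by (metis cmv_U_cmv_inv)
  then have "(\<lambda>n. cmv_U \<alpha> f n - complex_of_real t *s f n) = \<delta>"
    by (simp add: fun_eq_iff scaleR_eq_vector_smult)
  ultimately show ?thesis
    by blast
qed

text \<open>\<open>inv_into\<close> returns some preimage in \<open>ell2\<close>, so the bound is
  proved a priori for it: membership in \<open>ell2\<close> makes the supremum \<open>C\<close>
  finite, and applying the factor 3 twice gives \<open>C \<le> 9 (t C + 1)\<close>, hence
  \<open>C \<le> 20\<close> for \<open>t \<le> 1/20\<close>.\<close>

lemma cmv_resolvent_props:
  fixes k :: int and i :: 'm
  assumes t: "t \<in> {0..1/20}"
  defines "f \<equiv> cmv_resolvent \<alpha> (complex_of_real t) (unit_seq k i)"
  defines "e \<equiv> \<lambda>n. t *\<^sub>R f n + unit_seq k i n"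
  shows "f = pair_adj False \<alpha> (cmv_W \<alpha> f)" and "cmv_W \<alpha> f = pair_adj True \<alpha> e"
    and "norm (f n) \<le> 20" and "norm (cmv_W \<alpha> f n) \<le> 20"
proof -
  define \<Phi> where "\<Phi> = (\<lambda>f n. cmv_U \<alpha> f n - complex_of_real t *s f n)"
  have unit: "norm (unit_seq k i n) \<le> 1" for n
    by (simp add: unit_seq_def)
  have "\<exists>f\<in>ell2. \<Phi> f = unit_seq k i"
    unfolding \<Phi>_def
  proof (rule ex_resolvent[OF _ t])
    fix A :: "int set"
    assume A: "finite A"
    have "(\<Sum>n\<in>A. norm (unit_seq k i n)) = (\<Sum>n\<in>A. if n = k then 1 else 0)"
      by (intro sum.cong) (auto simp: unit_seq_def)
    then show "(\<Sum>n\<in>A. norm (unit_seq k i n)) \<le> 1"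
      using A by simp
  qed
  then have img: "unit_seq k i \<in> \<Phi> ` ell2"
    by force
  have f_eq: "f = inv_into ell2 \<Phi> (unit_seq k i)"
    by (simp add: f_def cmv_resolvent_def \<Phi>_def)
  have f: "f \<in> ell2" "\<Phi> f = unit_seq k i"
    unfolding f_eq using inv_into_into[OF img] f_inv_into_f[OF img] by simp_all
  have "cmv_U \<alpha> f = e"
    using f(2) by (auto simp: \<Phi>_def e_def fun_eq_iff scaleR_eq_vector_smult algebra_simps)
  then have "cmv_V \<alpha> (cmv_W \<alpha> f) = e"
    by (simp add: cmv_U_def)
  then show W: "cmv_W \<alpha> f = pair_adj True \<alpha> e"
    by (metis cmv_V_eq pair_adj_pair_op)
  show fW: "f = pair_adj False \<alpha> (cmv_W \<alpha> f)"
    by (simp add: cmv_W_eq pair_adj_pair_op)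
  define s where "s = (\<lambda>n. (norm (f n))\<^sup>2)"
  have "s summable_on UNIV"
    using f(1) by (simp add: ell2_def s_def)
  then have "sum s {n} \<le> infsum s UNIV" for n
    by (intro finite_sum_le_infsum) (auto simp: s_def)
  then have "norm (f n) \<le> sqrt (infsum s UNIV)" for n
    by (simp add: s_def real_le_rsqrt)
  then have bdd: "bdd_above (range (\<lambda>n. norm (f n)))"
    by (intro bdd_aboveI2)
  define C where "C = (SUP n. norm (f n))"
  have C: "norm (f n) \<le> C" for n
    unfolding C_def by (intro cSUP_upper bdd) simp
  have e: "norm (e n) \<le> t * C + 1" for n
  proof -
    have "norm (e n) \<le> t * norm (f n) + norm (unit_seq k i n)"
      unfolding e_def using t norm_triangle_ineq[of "t *\<^sub>R f n" "unit_seq k i n"] by simp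
    also have "\<dots> \<le> t * C + 1"
      using t by (intro add_mono mult_left_mono C unit) auto
    finally show ?thesis .
  qed
  have Wb: "norm (cmv_W \<alpha> f n) \<le> 3 * (t * C + 1)" for n
    unfolding W by (rule pair_adj_bounded[OF e])
  have "norm (f n) \<le> 3 * (3 * (t * C + 1))" for n
    by (subst fW) (rule pair_adj_bounded[OF Wb])
  then have "C \<le> 9 * (t * C + 1)"
    unfolding C_def[symmetric] by (subst (1) C_def) (intro cSUP_least, auto)
  then have C9: "C \<le> 9 * (t * C) + 9"
    by (simp add: algebra_simps)
  have "0 \<le> C"
    using C[of 0] norm_ge_zero order_trans by blast
  then have tC: "t * C \<le> 1 / 20 * C"
    using t by (intro mult_right_mono) auto
  show "norm (f n) \<le> 20"
    using C[of n] C9 tC by linarith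
  have "norm (cmv_W \<alpha> f n) \<le> 3 * (t * C) + 3"
    using Wb[of n] by (simp add: algebra_simps)
  then show "norm (cmv_W \<alpha> f n) \<le> 20"
    using C9 tC by linarith
qed

end

section \<open>From solutions for single unit vectors to matrix-valued columns\<close>

definition of_columns :: "('m \<Rightarrow> complex^'m) \<Rightarrow> 'm::finite cmatrix" where
  "of_columns x = of_mat (\<chi> i j. x j $ i)"

lemma of_columns_add: "of_columns (\<lambda>j. x j + y j) = of_columns x + of_columns y"
  by (simp add: of_columns_def plus_cmatrix.abs_eq vec_eq_iff of_mat_inject)

lemma of_columns_scaleR: "of_columns (\<lambda>j. c *\<^sub>R x j) = c *\<^sub>R of_columns x"
  by (simp add: of_columns_def scaleR_cmatrix.abs_eq vec_eq_iff of_mat_inject)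

lemma of_columns_matrix_vector: "of_columns (\<lambda>j. A *v x j) = of_mat A * of_columns x"
  by (simp add: of_columns_def times_cmatrix.abs_eq vec_eq_iff of_mat_inject matrix_vector_mult_def
      matrix_matrix_mult_def)

lemma of_columns_unit_seq: "of_columns (\<lambda>j. unit_seq k j n) = (if n = k then 1 else 0)"
  by (auto simp: of_columns_def one_cmatrix.abs_eq zero_cmatrix.abs_eq vec_eq_iff of_mat_inject
      unit_seq_def axis_def mat_def)

lemma of_columns_bounded: "\<exists>K. \<forall>x. (\<forall>j. norm (x j :: complex^'m) \<le> 20)
    \<longrightarrow> norm (of_columns x) \<le> K"
proof -
  obtain B where B: "\<And>A :: complex^'m^'m. norm (of_mat A) \<le> norm A * B" "0 < B"
    using bounded_linear.pos_bounded[OF bounded_linear_of_mat] by metis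
  have "norm (of_columns x) \<le> (\<Sum>i\<in>(UNIV :: 'm set). \<Sum>j\<in>(UNIV :: 'm set). 20) * B"
    if x: "\<And>j. norm (x j :: complex^'m) \<le> 20" for x
  proof -
    define A :: "complex^'m^'m" where "A = (\<chi> i j. x j $ i)"
    have "norm A \<le> (\<Sum>i\<in>UNIV. norm (A $ i))"
      by (simp add: norm_vec_def L2_set_le_sum)
    also have "\<dots> \<le> (\<Sum>i\<in>UNIV. \<Sum>j\<in>UNIV. norm (A $ i $ j))"
      by (rule sum_mono) (simp add: norm_vec_def L2_set_le_sum)
    also have "\<dots> \<le> (\<Sum>i\<in>(UNIV :: 'm set). \<Sum>j\<in>(UNIV :: 'm set). 20)"
      unfolding A_def using order_trans[OF Finite_Cartesian_Product.norm_nth_le x] by (intro sum_mono) simp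
    finally have "norm A * B \<le> (\<Sum>i\<in>(UNIV :: 'm set). \<Sum>j\<in>(UNIV :: 'm set). 20) * B"
      using B(2) by (intro mult_right_mono) auto
    then show ?thesis
      using B(1)[of A] by (simp add: of_columns_def A_def[symmetric])
  qed
  then show ?thesis
    by blast
qed

text \<open>The equations are linear with matrices acting from the left, so they pass from the
  solutions for the unit vectors to the matrices having these as columns.\<close>

lemma green_column_green:
  fixes \<alpha> :: "int \<Rightarrow> complex^'m^'m"
  assumes contr: "\<And>n. op_norm (\<alpha> n) < 1"
  shows "\<exists>v. green_column (\<lambda>n. of_mat (\<alpha> n)) k (\<lambda>n t. of_mat (green
      \<alpha> (complex_of_real t) n k)) v"
proof -
  define f where "f t j = cmv_resolvent \<alpha> (complex_of_real t) (unit_seq k j)" for t j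
  define w where "w t j = cmv_W \<alpha> (f t j)" for t j
  define u where "u n t = of_columns (\<lambda>j. f t j n)" for n t
  define v where "v n t = of_columns (\<lambda>j. w t j n)" for n t
  have u: "(\<lambda>n t. of_mat (green \<alpha> (complex_of_real t) n k)) = u"
    by (simp add: fun_eq_iff u_def of_columns_def green_def f_def)
  have ev: "eventually (\<lambda>t. t \<in> {0..1/20::real}) (at_right 0)"
    using eventually_at_right_real[of 0 "1/20"] by (simp add: eventually_mono)
  obtain K where K: "\<And>x. (\<And>j. norm (x j :: complex^'m) \<le> 20) \<Longrightarrow> norm
      (of_columns x) \<le> K"
    using of_columns_bounded by metis
  have f_eq: "f t j n = pair_adj False \<alpha> (w t j) n" if "t \<in> {0..1/20}" for t j n
    using cmv_resolvent_props(1)[where \<alpha> = \<alpha> and k = k and i = j, OF contr that] by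
        (metis f_def w_def)
  have w_eq: "w t j n = pair_adj True \<alpha> (\<lambda>n. t *\<^sub>R f t j n + unit_seq k j n) n" if
      "t \<in> {0..1/20}" for t j n
    using cmv_resolvent_props(2)[where \<alpha> = \<alpha> and k = k and i = j, OF contr that] by (simp
        add: f_def w_def)
  have forced: "forced k u n t = of_columns (\<lambda>j. t *\<^sub>R f t j n + unit_seq k j n)" for n t
    by (simp add: forced_def u_def of_columns_add of_columns_scaleR of_columns_unit_seq)
  have om: "of_mat (- A) = - of_mat A" for A :: "complex^'m^'m"
    by (simp add: uminus_cmatrix.abs_eq)
  note cols = of_columns_add of_columns_matrix_vector om of_mat_defect
  have "green_column (\<lambda>n. of_mat (\<alpha> n)) k u v"
  proof
    fix n :: int
    show "norm (of_mat (\<alpha> n)) < 1"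
      by (simp add: norm_of_mat contr)
    show "bdd (u n)"
      by (rule BfunI[of _ K]) (use ev in \<open>eventually_elim, auto simp: u_def f_def intro!: K
          cmv_resolvent_props contr\<close>)
    show "bdd (v n)"
      by (rule BfunI[of _ K]) (use ev in \<open>eventually_elim, auto simp: v_def w_def f_def intro!: K
          cmv_resolvent_props contr\<close>)
    fix t :: real
    assume t: "t \<in> {0..1/20}"
    {
      assume n: "odd n"
      have "u (n - 1) t = of_columns (\<lambda>j. pair_adj False \<alpha> (w t j) (n - 1))"
        by (simp add: u_def f_eq[OF t])
      then show "u (n - 1) t = - adj (of_mat (\<alpha> n)) * v (n - 1) t + defect (of_mat (\<alpha> n))
          * v n t"
        using n by (simp add: pair_adj_def cols v_def)
      have "u n t = of_columns (\<lambda>j. pair_adj False \<alpha> (w t j) n)"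
        by (simp add: u_def f_eq[OF t])
      then show "u n t = defect (adj (of_mat (\<alpha> n))) * v (n - 1) t + of_mat (\<alpha> n) * v n t"
        using n by (simp add: pair_adj_def cols v_def)
    next
      assume n: "even n"
      have "v (n - 1) t = of_columns (\<lambda>j. pair_adj True \<alpha> (\<lambda>n. t *\<^sub>R f t j
          n + unit_seq k j n) (n - 1))"
        by (simp add: v_def w_eq[OF t])
      then show "v (n - 1) t = - adj (of_mat (\<alpha> n)) * forced k u (n - 1) t + defect (of_mat
          (\<alpha> n)) * forced k u n t"
        using n by (simp add: forced pair_adj_def cols)
      have "v n t = of_columns (\<lambda>j. pair_adj True \<alpha> (\<lambda>n. t *\<^sub>R f t j n +
          unit_seq k j n) n)"
        by (simp add: v_def w_eq[OF t])
      then show "v n t = defect (adj (of_mat (\<alpha> n))) * forced k u (n - 1) t + of_mat (\<alpha>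
          n) * forced k u n t"
        using n by (simp add: forced pair_adj_def cols)
    }
  qed
  then show ?thesis
    unfolding u by blast
qed

text \<open>Restricts the complex limit to real positive \<open>z = t\<close>. In the application
  \<open>D\<close> is the sum of two norms, which dominates each of them, so one hypothesis serves
  for both summands.\<close>

lemma oeq_of_mat:
  fixes A B :: "complex \<Rightarrow> complex^'m^'m"
  assumes D: "D \<in> o[at 0](\<lambda>z. z ^ N)" and le: "\<And>z. op_norm (A z - B z) \<le> norm (D z)"
  shows "oeq N (\<lambda>t. of_mat (A (complex_of_real t))) (\<lambda>t. of_mat (B (complex_of_real t)))"
  unfolding oeq_def small_def
proof (rule ZfunI)
  fix r :: real
  assume r: "0 < r"
  have "eventually (\<lambda>z. norm (D z) \<le> r / 2 * norm (z ^ N)) (at 0)"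
    using landau_o.smallD[OF D, of "r / 2"] r by simp
  moreover have "filterlim complex_of_real (at 0) (at_right 0)"
    by (rule filterlim_atI)
       (auto intro!: tendsto_eq_intros simp: eventually_at_filter)
  ultimately have "eventually (\<lambda>t. norm (D (complex_of_real t)) \<le> r / 2 * norm
      (complex_of_real t ^ N)) (at_right 0)"
    by (rule eventually_compose_filterlim)
  with eventually_at_right_0
  show "eventually (\<lambda>t. norm ((of_mat (A (complex_of_real t)) - of_mat (B (complex_of_real t)))
      /\<^sub>R t ^ N) < r) (at_right 0)"
  proof eventually_elim
    case (elim t)
    have "norm (of_mat (A (complex_of_real t)) - of_mat (B (complex_of_real t)))
        = op_norm (A (complex_of_real t) - B (complex_of_real t))"
      by (simp add: minus_cmatrix.abs_eq norm_of_mat)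
    also have "\<dots> \<le> r / 2 * t ^ N"
      using le[of "complex_of_real t"] elim by (simp add: norm_power)
    also have "\<dots> < r * t ^ N"
      using elim r by simp
    finally show ?case
      unfolding norm_scaleR using elim by (simp add: field_simps)
  qed
qed

theorem theorem1p4:
  fixes \<alpha>1 \<alpha>2 :: "int \<Rightarrow> complex^'m^'m" and k0 :: int and N :: nat
  assumes "\<And>k. op_norm (\<alpha>1 k) < 1" and "\<And>k. op_norm (\<alpha>2 k) < 1"
  shows
    "((invertible (h_fun \<alpha>1 0 k0) \<or> invertible (h_fun \<alpha>2 0 k0)) \<and>
      (\<lambda>z. complex_of_real (op_norm (g_fun \<alpha>1 z k0 - g_fun \<alpha>2 z k0) +
                            op_norm (h_fun \<alpha>1 z k0 - h_fun \<alpha>2 z k0)))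
        \<in> o[at 0](\<lambda>z. z ^ N)
      \<longrightarrow> (\<forall>k. k0 - int N \<le> k \<and> k \<le> k0 + int N + 1 \<longrightarrow> \<alpha>1 k = \<alpha>2 k))
     \<and>
     (\<alpha>1 k0 = \<alpha>2 k0 \<and> invertible (\<alpha>1 k0) \<and>
      (\<lambda>z. complex_of_real (op_norm (g_fun \<alpha>1 z (k0 - 1) - g_fun \<alpha>2 z (k0 - 1)) +
                            op_norm (g_fun \<alpha>1 z k0 - g_fun \<alpha>2 z k0)))
        \<in> o[at 0](\<lambda>z. z ^ N)
      \<longrightarrow> (\<forall>k. k0 - int N - 1 \<le> k \<and> k \<le> k0 + int N + 1 \<longrightarrow> \<alpha>1 k = \<alpha>2 k))"
proof -
  define A1 A2 where A: "A1 n = of_mat (\<alpha>1 n)" "A2 n = of_mat (\<alpha>2 n)" for n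
  define u1 u2 where u: "u1 k n t = of_mat (green \<alpha>1 (complex_of_real t) n k)"
    "u2 k n t = of_mat (green \<alpha>2 (complex_of_real t) n k)" for k n t
  obtain v1 where s1: "\<And>k. green_column A1 k (u1 k) (v1 k)"
    using green_column_green[of \<alpha>1, OF assms(1)] unfolding A[abs_def] u[abs_def] by metis
  obtain v2 where s2: "\<And>k. green_column A2 k (u2 k) (v2 k)"
    using green_column_green[of \<alpha>2, OF assms(2)] unfolding A[abs_def] u[abs_def] by metis
  have eqI: "A1 k = A2 k \<Longrightarrow> \<alpha>1 k = \<alpha>2 k" for k
    by (simp add: A of_mat_inject)
  have norm_left: "op_norm X \<le> norm (complex_of_real (op_norm X + op_norm Y))"
    and norm_right: "op_norm Y \<le> norm (complex_of_real (op_norm X + op_norm Y))" for X Y ::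
        "complex^'m^'m"
    using norm_ge_zero[of "of_mat X"] norm_ge_zero[of "of_mat Y"] by (simp_all add: norm_of_mat del:
        of_real_add)
  have inv: "\<exists>d. of_mat X * d = 1 \<and> d * of_mat X = 1" if X: "invertible X" for X ::
      "complex^'m^'m"
  proof -
    obtain Y where "X ** Y = mat 1" "Y ** X = mat 1"
      using X unfolding invertible_def by blast
    then show ?thesis
      by (intro exI[of _ "of_mat Y"]) (simp add: times_cmatrix.abs_eq one_cmatrix.abs_eq)
  qed
  show ?thesis
  proof (intro conjI impI allI; elim conjE)
    fix k
    assume h0: "invertible (h_fun \<alpha>1 0 k0) \<or> invertible (h_fun \<alpha>2 0 k0)"
      and small: "(\<lambda>z. complex_of_real (op_norm (g_fun \<alpha>1 z k0 - g_fun \<alpha>2 z k0) +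
          op_norm (h_fun \<alpha>1 z k0 - h_fun \<alpha>2 z k0))) \<in> o[at 0](\<lambda>z. z ^ N)"
      and k: "k0 - int N \<le> k" "k \<le> k0 + int N + 1"
    have g: "oeq N (u1 k0 k0) (u2 k0 k0)"
      using oeq_of_mat[OF small norm_left] by (simp add: u[abs_def] g_fun_def)
    have h: "oeq N (\<lambda>t. of_mat (h_fun \<alpha>1 (complex_of_real t) k0)) (\<lambda>t. of_mat
        (h_fun \<alpha>2 (complex_of_real t) k0))"
      by (rule oeq_of_mat[OF small norm_right])
    have "A1 k = A2 k"
    proof (cases "even k0")
      case True
      \<comment> \<open>For even \<open>k0\<close> the entry \<open>(k0, k0 - 1)\<close> lies in
        column \<open>k0 - 1\<close>; in the odd case below, \<open>(k0 - 1, k0)\<close> lies in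
        column \<open>k0\<close>.\<close>
      then have h_eq: "of_mat (h_fun \<alpha>1 (complex_of_real t) k0) = u1 (k0 - 1) k0 t"
          "of_mat (h_fun \<alpha>2 (complex_of_real t) k0) = u2 (k0 - 1) k0 t" for t
        by (simp_all add: h_fun_def u)
      have h': "oeq N (u1 (k0 - 1) k0) (u2 (k0 - 1) k0)"
        using h by (simp add: h_eq)
      from h0 show ?thesis
      proof
        assume "invertible (h_fun \<alpha>1 0 k0)"
        then obtain d where "u1 (k0 - 1) k0 0 * d = 1" "d * u1 (k0 - 1) k0 0 = 1"
          using inv h_eq(1)[of 0] by fastforce
        from coefficients_eq_of_green_even[OF s1 s2 s1 s2 True g h' this k] show ?thesis .
      next
        assume "invertible (h_fun \<alpha>2 0 k0)"
        then obtain d where "u2 (k0 - 1) k0 0 * d = 1" "d * u2 (k0 - 1) k0 0 = 1"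
          using inv h_eq(2)[of 0] by fastforce
        \<comment> \<open>The two sequences exchange roles, since the lemma cancels by means of the
          first one.\<close>
        from coefficients_eq_of_green_even[OF s2 s1 s2 s1 True oeq_sym[OF g] oeq_sym[OF h'] this k]
        show ?thesis by simp
      qed
    next
      case False
      then have h_eq: "of_mat (h_fun \<alpha>1 (complex_of_real t) k0) = u1 k0 (k0 - 1) t"
          "of_mat (h_fun \<alpha>2 (complex_of_real t) k0) = u2 k0 (k0 - 1) t" for t
        by (simp_all add: h_fun_def u)
      have h': "oeq N (u1 k0 (k0 - 1)) (u2 k0 (k0 - 1))"
        using h by (simp add: h_eq)
      from h0 show ?thesis
      proof
        assume "invertible (h_fun \<alpha>1 0 k0)"
        then obtain d where "u1 k0 (k0 - 1) 0 * d = 1" "d * u1 k0 (k0 - 1) 0 = 1"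
          using inv h_eq(1)[of 0] by fastforce
        from coefficients_eq_of_green_odd[OF s1 s2 False g h' this k] show ?thesis .
      next
        assume "invertible (h_fun \<alpha>2 0 k0)"
        then obtain d where "u2 k0 (k0 - 1) 0 * d = 1" "d * u2 k0 (k0 - 1) 0 = 1"
          using inv h_eq(2)[of 0] by fastforce
        from coefficients_eq_of_green_odd[OF s2 s1 False oeq_sym[OF g] oeq_sym[OF h'] this k]
        show ?thesis by simp
      qed
    qed
    then show "\<alpha>1 k = \<alpha>2 k"
      by (rule eqI)
  next
    fix k
    assume a: "\<alpha>1 k0 = \<alpha>2 k0" "invertible (\<alpha>1 k0)"
      and small: "(\<lambda>z. complex_of_real (op_norm (g_fun \<alpha>1 z (k0 - 1) - g_fun \<alpha>2 z
          (k0 - 1)) +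
          op_norm (g_fun \<alpha>1 z k0 - g_fun \<alpha>2 z k0))) \<in> o[at 0](\<lambda>z. z ^ N)"
      and k: "k0 - int N - 1 \<le> k" "k \<le> k0 + int N + 1"
    have g': "oeq N (u1 (k0 - 1) (k0 - 1)) (u2 (k0 - 1) (k0 - 1))"
      using oeq_of_mat[OF small norm_left] by (simp add: u[abs_def] g_fun_def)
    have g: "oeq N (u1 k0 k0) (u2 k0 k0)"
      using oeq_of_mat[OF small norm_right] by (simp add: u[abs_def] g_fun_def)
    obtain d where "A1 k0 * d = 1" "d * A1 k0 = 1"
      using inv[OF a(2)] by (auto simp: A)
    from coefficients_eq_of_diagonals[OF s1 s2 s1 s2 g g' _ this k] a have "A1 k = A2 k"
      by (simp add: A)
    then show "\<alpha>1 k = \<alpha>2 k"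
      by (rule eqI)
  qed
qed

end
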